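(* Suppose $\mathcal{Q}$ is a quantity of interest and $Q\in W^{1,1}(0,\infty)$ is a corresponding family of numerical approximations. Furthermore, suppose that there are positive constants $\alpha,\ \beta\le 2\alpha,\ \gamma,\ c_1,\ c_2,\ c_3$ such that, for any $\ell>0$: (i) $\left|\mathbb{E}\left[\frac{\mathrm{d}Q(\ell)}{\mathrm{d}\ell}\right]\right|\le c_1 e^{-\alpha\ell}$; (ii) $\mathbb{V}\left[\frac{\mathrm{d}Q(\ell)}{\mathrm{d}\ell}\right]\le c_2 e^{-\beta\ell}$; (iii) $\mathcal{C}(\ell)\le c_3 e^{\gamma\ell}$, where $\mathcal{C}(\ell)$ is the cost to compute one sample of $Q(\ell)$. Furthermore, suppose that $L\sim\mathrm{Exponential}(r)$ with $r\in[\min(\beta,\gamma),\max(\beta,\gamma)]$. Then, for any $\varepsilon\in(0,e^{-1})$, there exist $L_{\max}\in[0,+\infty)$, $N\in\mathbb{N}$ and $C>0$ such that $$\mathrm{MSE}\le\varepsilon^2\quad\text{and}\quad \mathcal{C}^{\mathrm{CLMC}}_{L_{\max}}\le C\,\varepsilon^{-2-\max\left(0,\frac{\gamma-\beta}{\alpha}\right)}\,|\log\varepsilon|^{\delta_{r,\beta}+\delta_{r,\gamma}},$$ with $\delta$ denoting the Kronecker delta.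
   Context: $\mathcal{Q}$ is a scalar random quantity of interest, and $(Q(\ell))_{\ell\ge 0}$ is a stochastic process of numerical approximations of $\mathcal{Q}$, indexed by the continuous level of resolution $\ell$, with $Q(\ell)\to\mathcal{Q}$ almost surely as $\ell\to+\infty$. The condition $Q\in W^{1,1}(0,\infty)$ is understood for $Q$ as a function of $\ell$: $W^{1,1}(0,\infty)$ is the Sobolev space of functions over $\ell\in(0,\infty)$ such that the functions and their weak first derivatives have finite $L^1$ norm. $\frac{\mathrm{d}Q}{\mathrm{d}\ell}$ denotes the derivative with respect to $\ell$, and $\mathbb{V}$ denotes variance. $L$ is a random variable (the random finest level of resolution) independent of the whole process $(Q(\ell))_{\ell\ge0}$; $L\sim\mathrm{Exponential}(r)$ means $\mathbb{P}(L\ge\ell)=e^{-r\ell}$ for $\ell\ge0$. The continuous level Monte Carlo (CLMC) estimator is $$\widehat{Q}^{\mathrm{CLMC}}_{L_{\max}} := \frac{1}{N}\sum_{k=1}^{N}\int_0^{L_{\max}}\frac{1}{\mathbb{P}(L\ge \ell)}\left(\frac{\mathrm{d}Q}{\mathrm{d}\ell}\right)^{(k)}(\ell)\,\mathbf{1}_{[0,L^{(k)}]}(\ell)\,\mathrm{d}\ell,$$ where the superscript $(k)$ denotes the $k$-th realisation (independent samples) of the respective random variable, $N$ is the total number of samples, and $\mathbf{1}_A$ is the indicator function of $A$. Its mean-squared error is $$\mathrm{MSE}:=\mathbb{E}\left[\big(\widehat{Q}^{\mathrm{CLMC}}_{L_{\max}}-\mathbb{E}[\mathcal{Q}-Q(0)]\big)^2\right],$$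 and $\mathcal{C}^{\mathrm{CLMC}}_{L_{\max}}$ denotes its expected computational cost, $$\mathcal{C}^{\mathrm{CLMC}}_{L_{\max}} = N\,\mathbb{E}\left[\int_0^{L\wedge L_{\max}}\mathcal{C}(\ell)\,\mathrm{d}\ell\right],\qquad L\wedge L_{\max}=\min(L,L_{\max}).$$ *)

theory Defs
  imports "HOL-Probability.Probability"
begin

text \<open>Smooth functions with compact support in \<open>S\<close>, extended by zero to the whole line.\<close>

definition test_function :: "real set \<Rightarrow> (real \<Rightarrow> real) \<Rightarrow> bool" where
  "test_function S \<phi> \<longleftrightarrow>
     (\<forall>n. (deriv ^^ n) \<phi> differentiable_on UNIV) \<and>
     compact (closure {x. \<phi> x \<noteq> 0}) \<and> closure {x. \<phi> x \<noteq> 0} \<subseteq> S"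

definition locally_integrable :: "real set \<Rightarrow> (real \<Rightarrow> real) \<Rightarrow> bool" where
  "locally_integrable S f \<longleftrightarrow> (\<forall>K. compact K \<longrightarrow> K \<subseteq> S \<longrightarrow> set_integrable lborel K f)"

definition has_weak_derivative :: "real set \<Rightarrow> (real \<Rightarrow> real) \<Rightarrow> (real \<Rightarrow> real) \<Rightarrow> bool" where
  "has_weak_derivative S f g \<longleftrightarrow>
     locally_integrable S f \<and> locally_integrable S g \<and>
     (\<forall>\<phi>. test_function S \<phi> \<longrightarrow>
        (LBINT x:S. f x * deriv \<phi> x) = - (LBINT x:S. g x * \<phi> x))"

definition sobolev_W11 :: "real set \<Rightarrow> (real \<Rightarrow> real) set" where
  "sobolev_W11 S = {f. set_integrable lborel S f \<and>
     (\<exists>g. has_weak_derivative S f g \<and> set_integrable lborel S g)}"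

text \<open>
  The library's \<open>indep_var\<close> needs both random variables to take values in the same type; this
  is its analogue, independence of the generated \<open>\<sigma>\<close>-algebras, for different target types.
\<close>

definition indep_rvs ::
    "'a measure \<Rightarrow> 'c measure \<Rightarrow> ('a \<Rightarrow> 'c) \<Rightarrow> 'd measure \<Rightarrow> ('a \<Rightarrow> 'd) \<Rightarrow> bool" where
  "indep_rvs M A Y B Z \<longleftrightarrow> Y \<in> measurable M A \<and> Z \<in> measurable M B \<and>
     prob_space.indep_set M (sets (vimage_algebra (space M) Y A)) (sets (vimage_algebra (space M) Z B))"

text \<open>
  Realisations: \<open>(M, Q, L)\<close> is the probabilistic model, and the \<open>k\<close>-th realisation of a
  random variable \<open>Z\<close> on \<open>M\<close> is \<open>Z \<circ> X k\<close>, where the \<open>X k\<close> are independent draws from \<open>M\<close>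
  defined on some probability space \<open>P\<close>.
\<close>

definition iid_samples :: "'a measure \<Rightarrow> 'b measure \<Rightarrow> (nat \<Rightarrow> 'b \<Rightarrow> 'a) \<Rightarrow> bool" where
  "iid_samples M P X \<longleftrightarrow>
     prob_space P \<and> prob_space.indep_vars P (\<lambda>_. M) X UNIV \<and> (\<forall>k. distr P M (X k) = M)"

definition clmc_summand ::
    "'a measure \<Rightarrow> (real \<Rightarrow> 'a \<Rightarrow> real) \<Rightarrow> ('a \<Rightarrow> real) \<Rightarrow> real \<Rightarrow> 'a \<Rightarrow> real" where
  "clmc_summand M DQ L Lmax \<omega> =
     (LBINT l:{0..Lmax}.
        1 / measure M {\<omega>' \<in> space M. L \<omega>' \<ge> l} * DQ l \<omega> * indicator {0..L \<omega>} l)"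

definition clmc_estimator ::
    "'a measure \<Rightarrow> (real \<Rightarrow> 'a \<Rightarrow> real) \<Rightarrow> ('a \<Rightarrow> real) \<Rightarrow> (nat \<Rightarrow> 'b \<Rightarrow> 'a) \<Rightarrow>
       real \<Rightarrow> nat \<Rightarrow> 'b \<Rightarrow> real" where
  "clmc_estimator M DQ L X Lmax N \<xi> =
     1 / real N * (\<Sum>k=1..N. clmc_summand M DQ L Lmax (X k \<xi>))"

definition mean_squared_error :: "'b measure \<Rightarrow> ('b \<Rightarrow> real) \<Rightarrow> real \<Rightarrow> real" where
  "mean_squared_error P Y m = prob_space.expectation P (\<lambda>\<xi>. (Y \<xi> - m)\<^sup>2)"

definition clmc_cost ::
    "'a measure \<Rightarrow> ('a \<Rightarrow> real) \<Rightarrow> (real \<Rightarrow> real) \<Rightarrow> real \<Rightarrow> nat \<Rightarrow> real" where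
  "clmc_cost M L cost Lmax N =
     real N * prob_space.expectation M (\<lambda>\<omega>. LBINT l:{0..min (L \<omega>) Lmax}. cost l)"

definition kronecker_delta :: "real \<Rightarrow> real \<Rightarrow> nat" where
  "kronecker_delta x y = (if x = y then 1 else 0)"

end

theory Submission
  imports Defs
begin

text \<open>
  Since \<open>\<beta> \<le> 2 * \<alpha>\<close>, the second moment of the derivative at level \<open>l\<close> is at most \<open>K\<^sup>2 * exp (- \<beta> * l)\<close>
  with \<open>K\<^sup>2 = c1\<^sup>2 + c2\<close>. A continuous function is the integral of its weak derivative (test against
  mollified indicators of intervals), so the integral \<open>F t\<close> of \<open>exp (r * l)\<close> times the derivative
  over \<open>0 < l \<le> t\<close> is an almost sure limit of Riemann-Stieltjes sums in \<open>Q\<close>, hence independent of \<open>L\<close>.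
  One summand of the estimator is \<open>F (min L Lmax)\<close>. By independence \<open>L\<close> can be frozen; this gives the
  mean \<open>E (Q Lmax - Q 0)\<close> and, by a pathwise Cauchy-Schwarz inequality with weight \<open>exp (s * l)\<close>,
  \<open>2 * s = max (2 * r - \<beta>) (r / 2)\<close>, a second moment controlled by the integral of
  \<open>exp ((2 * s - r) * l)\<close> up to \<open>Lmax\<close>. The expected cost per sample is controlled by the integral of
  \<open>exp ((\<gamma> - r) * l)\<close>. Each of the two integrals contributes one Kronecker delta, for a vanishing
  exponent. Take \<open>Lmax\<close> of order \<open>ln (1 / \<epsilon>) / \<alpha>\<close>, so that the bias is at most \<open>\<epsilon> / 2\<close>, and for \<open>N\<close> the
  second moment bound times \<open>2 / \<epsilon>\<^sup>2\<close>.
\<close>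

section \<open>Weak derivatives of continuous functions\<close>

text \<open>Only the process \<open>Q\<close> is independent of \<open>L\<close>. At any single
  level \<open>DQ l\<close> may be changed, even in a way that involves \<open>L\<close>, without
  affecting the weak derivative; so the expectation of \<open>DQ l\<close> times the indicator of
  \<open>l \<le> L\<close> cannot be factored level by level. Whatever needs independence is
  therefore stated for F t as a whole: almost surely it is determined by increments of
  \<open>Q\<close>, and it is continuous in t, so that \<open>L\<close> may be rounded to a grid and
  each grid value treated as a constant. Continuity of the paths gives the point values of
  \<open>Q\<close>, and thereby its increments, a meaning; a weak derivative alone fixes
  \<open>Q\<close> only almost everywhere. The moment hypotheses control one level at a time. The
  pathwise Cauchy-Schwarz inequality matches this: after it only squares at a single level remain,
  and no covariance between levels enters. The constant C is chosen before \<epsilon>, so each bound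
  has to display its dependence on \<epsilon> explicitly.\<close>

definition flat :: "nat \<Rightarrow> real \<Rightarrow> real" where
  "flat k x = (if x > 0 then (1 / x) ^ k * exp (- (1 / x)) else 0)"

text \<open>Substituting y = 1 / x turns the quotient into y^(k+1) / exp y. Dividing by x makes it
  the difference quotient at 0, which is the only delicate point for differentiability.\<close>

lemma flat_right_limit: "((\<lambda>x. flat k x / x) \<longlongrightarrow> 0) (at_right 0)"
proof -
  have "((\<lambda>y. y ^ Suc k / exp y) \<longlongrightarrow> (0::real)) at_top"
    by (rule tendsto_power_div_exp_0)
  then have "((\<lambda>x. inverse x ^ Suc k / exp (inverse x)) \<longlongrightarrow> (0::real)) (at_right 0)"
    using filterlim_compose filterlim_inverse_at_top_right by blast
  moreover have "eventually (\<lambda>x. inverse x ^ Suc k / exp (inverse x) = flat k x / x) (at_right 0)"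
    unfolding eventually_at_right_field
    by (intro exI[of _ 1]) (auto simp: flat_def exp_minus field_simps)
  ultimately show ?thesis
    by (rule Lim_transform_eventually)
qed

text \<open>Differentiating exp (-1/x) produces powers of 1 / x. With all powers in the family, its
  linear span is closed under differentiation, at the origin as well.\<close>

lemma has_real_derivative_flat:
  "(flat k has_real_derivative (flat (k + 2) x + - real k * flat (k + 1) x)) (at x)"
proof -
  consider "x > 0" | "x < 0" | "x = 0" by linarith
  then show ?thesis
  proof cases
    case 1
    define y where "y = 1 / x"
    have "((\<lambda>x. (1 / x) ^ k * exp (- (1 / x))) has_real_derivative
        (exp (- y) * y\<^sup>2 * y ^ k - real k * y ^ (k - 1) * y\<^sup>2 * exp (- y))) (at x)"
      unfolding y_def using 1
      by (auto intro!: derivative_eq_intros simp: power2_eq_square)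
    moreover have "real k * y ^ (k - 1) * y\<^sup>2 = real k * y ^ (k + 1)"
      by (cases k) (auto simp: power2_eq_square)
    then have "exp (- y) * y\<^sup>2 * y ^ k - real k * y ^ (k - 1) * y\<^sup>2 * exp (- y) =
        flat (k + 2) x + - real k * flat (k + 1) x"
      using 1 by (simp only:) (simp add: flat_def y_def[symmetric] power2_eq_square algebra_simps)
    ultimately have "((\<lambda>x. (1 / x) ^ k * exp (- (1 / x))) has_real_derivative
        (flat (k + 2) x + - real k * flat (k + 1) x)) (at x)"
      by (simp only:)
    then show ?thesis
    proof (rule has_field_derivative_transform_within_open[where S="{0<..}"])
    qed (use 1 in \<open>auto simp: flat_def\<close>)
  next
    case 2
    have "((\<lambda>x. 0) has_real_derivative (flat (k + 2) x + - real k * flat (k + 1) x)) (at x)"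
      using 2 by (simp add: flat_def)
    then show ?thesis
    proof (rule has_field_derivative_transform_within_open[where S="{..<0}"])
    qed (use 2 in \<open>auto simp: flat_def\<close>)
  next
    case 3
    have "((\<lambda>y. flat k y / y) \<longlongrightarrow> 0) (at_left 0)"
    proof (rule Lim_transform_eventually)
      show "((\<lambda>y. 0::real) \<longlongrightarrow> 0) (at_left 0)" by simp
      show "eventually (\<lambda>y. 0 = flat k y / y) (at_left 0)"
        unfolding eventually_at_left_field by (intro exI[of _ "-1"]) (auto simp: flat_def)
    qed
    then have "((\<lambda>y. flat k y / y) \<longlongrightarrow> 0) (at 0)"
      using flat_right_limit by (simp add: filterlim_split_at)
    then show ?thesis
      using 3 by (simp add: has_field_derivative_iff flat_def)
  qed
qed

text \<open>An algebra of functions closed under \<open>deriv\<close>: one differentiation step then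
  yields all iterates \<open>deriv ^^ n\<close> by induction. Affine arguments are built into the
  generators, since scaled and shifted steps are the only compositions needed.\<close>

inductive smooth_fun :: "(real \<Rightarrow> real) \<Rightarrow> bool" where
  flat: "smooth_fun (\<lambda>x. flat k (c * x + d))"
| const: "smooth_fun (\<lambda>x. c)"
| add: "smooth_fun f \<Longrightarrow> smooth_fun g \<Longrightarrow> smooth_fun (\<lambda>x. f x + g x)"
| mult: "smooth_fun f \<Longrightarrow> smooth_fun g \<Longrightarrow> smooth_fun (\<lambda>x. f x * g x)"
| inverse: "smooth_fun f \<Longrightarrow> (\<And>x. f x \<noteq> 0) \<Longrightarrow> smooth_fun (\<lambda>x. inverse (f x))"

lemma smooth_fun_has_derivative:
  assumes "smooth_fun f"
  shows "\<exists>g. smooth_fun g \<and> (\<forall>x. (f has_real_derivative g x) (at x))"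
  using assms
proof induction
  case (flat k c d)
  have "((\<lambda>x. flat k (c * x + d)) has_real_derivative
      (flat (k + 2) (c * x + d) + - real k * flat (k + 1) (c * x + d)) * c) (at x)" for x
    by (rule DERIV_chain'[where g="flat k", OF _ has_real_derivative_flat])
       (auto intro!: derivative_eq_intros)
  moreover have "smooth_fun (\<lambda>x. (flat (k + 2) (c * x + d) + - real k * flat (k + 1) (c * x + d)) * c)"
    by (intro smooth_fun.intros)
  ultimately show ?case by blast
next
  case (const c)
  show ?case by (rule exI[of _ "\<lambda>x. 0"]) (auto intro: smooth_fun.intros)
next
  case (add f g)
  then obtain f' g' where "smooth_fun f'" "smooth_fun g'"
    "\<And>x. (f has_real_derivative f' x) (at x)" "\<And>x. (g has_real_derivative g' x) (at x)"
    by blast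
  then show ?case
    by (intro exI[of _ "\<lambda>x. f' x + g' x"]) (auto intro: smooth_fun.intros derivative_intros)
next
  case (mult f g)
  then obtain f' g' where *: "smooth_fun f'" "smooth_fun g'"
    "\<And>x. (f has_real_derivative f' x) (at x)" "\<And>x. (g has_real_derivative g' x) (at x)"
    by blast
  have "smooth_fun (\<lambda>x. f' x * g x + g' x * f x)"
    using * mult by (intro smooth_fun.intros)
  then show ?case
    using DERIV_mult[OF *(3,4)] by blast
next
  case (inverse f)
  then obtain f' where *: "smooth_fun f'" "\<And>x. (f has_real_derivative f' x) (at x)"
    by blast
  have "smooth_fun (\<lambda>x. - 1 * (inverse (f x) * f' x * inverse (f x)))"
    using * inverse by (intro smooth_fun.intros)
  moreover have "((\<lambda>x. inverse (f x)) has_real_derivative - 1 * (inverse (f x) * f' x * inverse (f x))) (at x)" for x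
    using DERIV_inverse'[OF *(2) inverse(2)] by simp
  ultimately show ?case by blast
qed

lemma smooth_fun_deriv:
  assumes "smooth_fun f"
  shows "smooth_fun (deriv f)" "(f has_real_derivative deriv f x) (at x)" "continuous_on A f"
proof -
  obtain g where g: "smooth_fun g" "\<And>x. (f has_real_derivative g x) (at x)"
    using smooth_fun_has_derivative[OF assms] by blast
  then have "deriv f = g" by (auto intro: DERIV_imp_deriv)
  then show "smooth_fun (deriv f)" "(f has_real_derivative deriv f x) (at x)" using g by auto
  show "continuous_on A f"
    using g(2) by (meson DERIV_isCont continuous_at_imp_continuous_on)
qed

lemma smooth_fun_test_function:
  assumes "smooth_fun f" "{x. f x \<noteq> 0} \<subseteq> K" "compact K" "K \<subseteq> S"
  shows "test_function S f"
proof -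
  have "smooth_fun ((deriv ^^ n) f)" for n
    by (induction n) (auto intro: assms smooth_fun_deriv)
  then have "(deriv ^^ n) f differentiable_on UNIV" for n
    unfolding differentiable_on_def
    by (meson smooth_fun_deriv(2) real_differentiable_def)
  moreover have "closure {x. f x \<noteq> 0} \<subseteq> K"
    using assms closure_minimal compact_imp_closed by blast
  moreover from this have "compact (closure {x. f x \<noteq> 0})"
    using assms(3) by (metis closed_closure compact_Int_closed inf.absorb2)
  ultimately show ?thesis
    using assms(4) unfolding test_function_def by blast
qed

section \<open>The classical smooth transition from 0 to 1 and its derivative, supported in the unit
  interval\<close>

definition smooth_step :: "real \<Rightarrow> real" where
  "smooth_step x = flat 0 x * inverse (flat 0 x + flat 0 (1 - x))"

lemma smooth_step_denominator: "flat 0 x + flat 0 (1 - x) > 0"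
  by (auto simp: flat_def add_pos_pos)

lemma smooth_fun_smooth_step: "smooth_fun (\<lambda>x. smooth_step (c * x + d))"
proof -
  have "smooth_fun (\<lambda>x. flat 0 (c * x + d) * inverse (flat 0 (c * x + d) + flat 0 ((- c) * x + (1 - d))))"
  proof (intro smooth_fun.intros)
    show "flat 0 (c * x + d) + flat 0 (- c * x + (1 - d)) \<noteq> 0" for x
      using smooth_step_denominator[of "c * x + d"] by (simp add: algebra_simps)
  qed
  then show ?thesis by (simp add: smooth_step_def algebra_simps)
qed

lemma smooth_step_le_0 [simp]: "x \<le> 0 \<Longrightarrow> smooth_step x = 0"
  by (simp add: smooth_step_def flat_def)

lemma smooth_step_ge_1 [simp]: "x \<ge> 1 \<Longrightarrow> smooth_step x = 1"
  by (simp add: smooth_step_def flat_def)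

lemma smooth_step_bounds: "0 \<le> smooth_step x" "smooth_step x \<le> 1"
  using smooth_step_denominator[of x]
  by (auto simp: smooth_step_def flat_def field_simps)

lemma smooth_fun_smooth_step_id: "smooth_fun smooth_step"
  using smooth_fun_smooth_step[of 1 0] by simp

lemmas smooth_step_deriv = smooth_fun_deriv[OF smooth_fun_smooth_step_id]

lemma deriv_smooth_step_eq_0:
  assumes "x \<notin> {0..1}"
  shows "deriv smooth_step x = 0"
proof -
  from assms consider "x < 0" | "x > 1" by force
  then show ?thesis
  proof cases
    case 1
    have "(smooth_step has_real_derivative 0) (at x)"
      by (rule has_field_derivative_transform_within_open[where S="{..<0}", OF DERIV_const[of 0]])
         (use 1 in auto)
    then show ?thesis by (rule DERIV_imp_deriv)
  next
    case 2
    have "(smooth_step has_real_derivative 0) (at x)"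
      by (rule has_field_derivative_transform_within_open[where S="{1<..}", OF DERIV_const[of 1]])
         (use 2 in auto)
    then show ?thesis by (rule DERIV_imp_deriv)
  qed
qed

lemma integral_deriv_smooth_step: "(LBINT u:{0..1}. deriv smooth_step u) = 1"
proof -
  have "(LBINT u:{0..1}. deriv smooth_step u) = smooth_step 1 - smooth_step 0"
    unfolding set_lebesgue_integral_def
    by (rule integral_FTC_atLeastAtMost)
       (use smooth_step_deriv(2) in \<open>auto intro: smooth_fun_deriv(3)[OF smooth_step_deriv(1)]
          has_vector_derivative_at_within simp: has_real_derivative_iff_has_vector_derivative\<close>)
  then show ?thesis by simp
qed


section \<open>Mollified point values and the fundamental theorem for weak derivatives\<close>

lemma mollifier_integral:
  fixes f :: "real \<Rightarrow> real"
  assumes f: "continuous_on {0..} f" and c: "c > 0" and n: "n > 0"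
  defines "g \<equiv> \<lambda>x. indicator {0<..} x * (f x * (n * deriv smooth_step (n * (x - c))))"
  shows "integrable lborel g"
    and "(LBINT x. g x) = (LBINT u:{0..1}. f (c + u / n) * deriv smooth_step u)"
proof -
  \<comment> \<open>The substitution x = c + u / n. Off the unit interval the derivative of the step
    vanishes, and on it c > 0 makes the half-line indicator equal to 1, so one indicator replaces
    the other.\<close>
  have g: "g (c + 1 / n * u) = n * (indicator {0..1} u * (f (c + u / n) * deriv smooth_step u))" for u
  proof (cases "u \<in> {0..1}")
    case True
    then have "c + u / n > 0" using c n by (simp add: add_pos_nonneg)
    then show ?thesis using True n by (simp add: g_def)
  next
    case False
    then show ?thesis using n deriv_smooth_step_eq_0[OF False] by (simp add: g_def)
  qed
  have "continuous_on {0..1} (\<lambda>u. f (c + u / n) * deriv smooth_step u)"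
    using c n by (intro continuous_intros continuous_on_compose2[OF f] smooth_fun_deriv(3)[OF smooth_step_deriv(1)])
      (auto intro!: add_nonneg_nonneg)
  then have "integrable lborel (\<lambda>u. indicator {0..1} u * (f (c + u / n) * deriv smooth_step u))"
    using borel_integrable_atLeastAtMost' by (force simp: set_integrable_def)
  then have "integrable lborel (\<lambda>u. g (c + 1 / n * u))"
    unfolding g by simp
  then show "integrable lborel g"
    using lborel_integrable_real_affine_iff[of "1 / n" g c] n by simp
  have "(LBINT x. g x) = 1 / n * (LBINT u. g (c + 1 / n * u))"
    using lborel_integral_real_affine[of "1 / n" g c] n by simp
  then show "(LBINT x. g x) = (LBINT u:{0..1}. f (c + u / n) * deriv smooth_step u)"
    unfolding g set_lebesgue_integral_def using n by simp
qed

text \<open>The mollifier has mass 1 and sits to the right of c within distance 1, so every sampled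
  point lies in the compact interval {c..c + 1}; boundedness there gives the dominating
  function.\<close>

lemma mollified_value_tendsto:
  fixes f :: "real \<Rightarrow> real"
  assumes f: "continuous_on {0..} f" and c: "c > 0"
  shows "(\<lambda>n. LBINT u:{0..1}. f (c + u / real (Suc n)) * deriv smooth_step u) \<longlonglongrightarrow> f c"
proof -
  have h: "continuous_on A (deriv smooth_step)" for A
    by (rule smooth_fun_deriv(3)[OF smooth_step_deriv(1)])
  have "compact (f ` {c..c + 1})" "compact (deriv smooth_step ` {0..1})"
    using c by (auto intro!: compact_continuous_image continuous_on_subset[OF f] h)
  then obtain B B' where B: "\<And>x. x \<in> {c..c + 1} \<Longrightarrow> \<bar>f x\<bar> \<le> B"
      "\<And>x. x \<in> {0..1} \<Longrightarrow> \<bar>deriv smooth_step x\<bar> \<le> B'"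
    using compact_imp_bounded by (fastforce simp: bounded_iff)
  have in_range: "c + u / real (Suc n) \<in> {c..c + 1}" if "u \<in> {0..1}" for u n
  proof -
    have "u / real (Suc n) \<le> 1 / 1" using that by (intro frac_le) auto
    then show ?thesis using that by auto
  qed
  have "(\<lambda>n. LBINT u. indicator {0..1} u *\<^sub>R (f (c + u / real (Suc n)) * deriv smooth_step u)) \<longlonglongrightarrow>
      (LBINT u. indicator {0..1} u *\<^sub>R (f c * deriv smooth_step u))"
  proof (rule integral_dominated_convergence[where w="\<lambda>u. indicator {0..1} u * (B * B')"])
    show "integrable lborel (\<lambda>u::real. indicator {0..1} u * (B * B'))"
      by (rule integrable_mult_left) auto
    show "(\<lambda>u. indicator {0..1} u *\<^sub>R (f c * deriv smooth_step u)) \<in> borel_measurable lborel"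
      using borel_integrable_atLeastAtMost'[OF continuous_on_mult_left[OF h], of 0 1 "f c"]
      by (auto simp: set_integrable_def)
    show "(\<lambda>u. indicator {0..1} u *\<^sub>R (f (c + u / real (Suc n)) * deriv smooth_step u)) \<in> borel_measurable lborel" for n
    proof -
      have "continuous_on {0..1} (\<lambda>u. f (c + u / real (Suc n)) * deriv smooth_step u)"
        using c in_range[of _ n] by (intro continuous_intros continuous_on_compose2[OF f] h) force+
      then show ?thesis
        using borel_integrable_atLeastAtMost' by (force simp: set_integrable_def)
    qed
    show "AE u in lborel. norm (indicator {0..1} u *\<^sub>R (f (c + u / real (Suc n)) * deriv smooth_step u))
        \<le> indicator {0..1} u * (B * B')" for n
    proof (intro always_eventually allI)
      fix u :: real
      show "norm (indicator {0..1} u *\<^sub>R (f (c + u / real (Suc n)) * deriv smooth_step u))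
        \<le> indicator {0..1} u * (B * B')"
      proof (cases "u \<in> {0..1}")
        case True
        have "\<bar>f (c + u / real (Suc n))\<bar> * \<bar>deriv smooth_step u\<bar> \<le> B * B'"
          using B(1)[OF in_range[OF True]] B(2)[OF True]
            order_trans[OF abs_ge_zero B(1)[OF in_range[OF True, of 0]]]
          by (intro mult_mono) auto
        then show ?thesis using True by (simp add: abs_mult)
      qed simp
    qed
    show "AE u in lborel. (\<lambda>n. indicator {0..1} u *\<^sub>R (f (c + u / real (Suc n)) * deriv smooth_step u))
        \<longlonglongrightarrow> indicator {0..1} u *\<^sub>R (f c * deriv smooth_step u)"
    proof (intro always_eventually allI)
      fix u :: real
      show "(\<lambda>n. indicator {0..1} u *\<^sub>R (f (c + u / real (Suc n)) * deriv smooth_step u))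
        \<longlonglongrightarrow> indicator {0..1} u *\<^sub>R (f c * deriv smooth_step u)"
      proof (cases "u \<in> {0..1}")
        case True
        have "(\<lambda>n. u * inverse (real (Suc n))) \<longlonglongrightarrow> u * 0"
          by (intro tendsto_intros LIMSEQ_inverse_real_of_nat)
        then have "(\<lambda>n. c + u / real (Suc n)) \<longlonglongrightarrow> c + 0"
          by (intro tendsto_intros) (simp add: divide_inverse)
        then have "(\<lambda>n. f (c + u / real (Suc n))) \<longlonglongrightarrow> f c"
          using c in_range[OF True]
          by (intro continuous_on_tendsto_compose[OF f]) (auto intro!: always_eventually order.trans[of 0 c])
        then show ?thesis by (intro tendsto_intros)
      qed simp
    qed
  qed
  also have "(LBINT u. indicator {0..1} u *\<^sub>R (f c * deriv smooth_step u)) = f c * (LBINT u:{0..1}. deriv smooth_step u)"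
    by (simp add: set_lebesgue_integral_def mult.left_commute)
  finally show ?thesis
    unfolding integral_deriv_smooth_step by (simp add: set_lebesgue_integral_def)
qed

text \<open>For a smoothed indicator as test function, the derivative concentrates mass 1 at a and
  mass -1 at b, which reads off f a - f b; the function itself turns the other side into the
  integral of g. Positivity of a keeps the support inside the open half-line.\<close>

lemma weak_derivative_FTC_pos:
  fixes f g :: "real \<Rightarrow> real"
  assumes weak: "has_weak_derivative {0<..} f g" and f: "continuous_on {0..} f"
    and g: "set_integrable lborel {0<..} g" and ab: "0 < a" "a \<le> b"
  shows "f b - f a = (LBINT x:{a<..b}. g x)"
proof -
  \<comment> \<open>Each step rises to the right of its base point. Hence the pointwise limit is, at
    every point, exactly the indicator of the half-open interval {a<..b}.\<close>
  define \<phi> where "\<phi> n x = smooth_step (real (Suc n) * (x - a)) - smooth_step (real (Suc n) * (x - b))" for n x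
  have step: "smooth_fun (\<lambda>x. smooth_step (real (Suc n) * (x - c)))" for n c
    using smooth_fun_smooth_step[of "real (Suc n)" "- real (Suc n) * c"] by (simp add: algebra_simps)
  have "smooth_fun (\<lambda>x. smooth_step (real (Suc n) * (x - a)) + - 1 * smooth_step (real (Suc n) * (x - b)))" for n
    by (intro smooth_fun.add smooth_fun.mult smooth_fun.const step)
  then have smooth: "smooth_fun (\<phi> n)" for n
    by (simp add: \<phi>_def[abs_def])
  have ge1: "1 \<le> real (Suc n) * (x - c)" if "x \<ge> c + 1" for n x c
    using that mult_mono[of 1 "real (Suc n)" 1 "x - c"] by simp
  \<comment> \<open>The steepness is at least 1, so both steps have reached 1 at distance 1 from
    their base points and cancel beyond b + 1: one compact set serves all n.\<close>
  have supp: "x \<in> {a..b + 1}" if "\<phi> n x \<noteq> 0" for n x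
  proof (rule ccontr)
    assume "x \<notin> {a..b + 1}"
    then consider "x < a" | "x > b + 1" by force
    then have "\<phi> n x = 0"
    proof cases
      case 1
      then show ?thesis using ab by (simp add: \<phi>_def mult_nonneg_nonpos)
    next
      case 2
      then show ?thesis using ab ge1[of a x n] ge1[of b x n] by (simp add: \<phi>_def)
    qed
    with that show False by simp
  qed
  have test: "test_function {0<..} (\<phi> n)" for n
    by (rule smooth_fun_test_function[OF smooth, where K="{a..b + 1}"]) (use supp ab in auto)
  have deriv_\<phi>: "deriv (\<phi> n) x = real (Suc n) * deriv smooth_step (real (Suc n) * (x - a))
      - real (Suc n) * deriv smooth_step (real (Suc n) * (x - b))" for n x
  proof (rule DERIV_imp_deriv)
    have "((\<lambda>x. smooth_step (real (Suc n) * (x - c))) has_real_derivative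
        deriv smooth_step (real (Suc n) * (x - c)) * real (Suc n)) (at x)" for c
      by (rule DERIV_chain'[where g=smooth_step, OF _ smooth_step_deriv(2)])
         (auto intro!: derivative_eq_intros)
    from DERIV_diff[OF this[of a] this[of b]]
    show "(\<phi> n has_real_derivative real (Suc n) * deriv smooth_step (real (Suc n) * (x - a))
      - real (Suc n) * deriv smooth_step (real (Suc n) * (x - b))) (at x)"
      unfolding \<phi>_def[abs_def] by (simp add: mult.commute)
  qed
  define I where "I c n = (LBINT u:{0..1}. f (c + u / real (Suc n)) * deriv smooth_step u)" for c n
  have eq: "I a n - I b n = - (LBINT x:{0<..}. g x * \<phi> n x)" for n
  proof -
    have pos: "0 < a" "0 < b" "0 < real (Suc n)" using ab by auto
    have "(LBINT x:{0<..}. f x * deriv (\<phi> n) x) =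
      (LBINT x. indicator {0<..} x * (f x * (real (Suc n) * deriv smooth_step (real (Suc n) * (x - a)))) -
          indicator {0<..} x * (f x * (real (Suc n) * deriv smooth_step (real (Suc n) * (x - b)))))"
      unfolding set_lebesgue_integral_def deriv_\<phi> by (simp add: algebra_simps)
    also have "\<dots> = I a n - I b n"
      using mollifier_integral[OF f pos(1,3)] mollifier_integral[OF f pos(2,3)]
      by (subst Bochner_Integration.integral_diff) (auto simp: I_def)
    finally show ?thesis
      using weak test[of n] unfolding has_weak_derivative_def by metis
  qed
  have "(\<lambda>n. I a n - I b n) \<longlonglongrightarrow> f a - f b"
    unfolding I_def using ab by (intro tendsto_intros mollified_value_tendsto f) auto
  then have lim1: "(\<lambda>n. LBINT x:{0<..}. g x * \<phi> n x) \<longlonglongrightarrow> f b - f a"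
    unfolding eq using tendsto_minus by fastforce
  have int: "integrable lborel (\<lambda>x. indicator {0<..} x * g x)"
    using g by (simp add: set_integrable_def)
  have "(\<lambda>n. LBINT x. indicator {0<..} x *\<^sub>R (g x * \<phi> n x)) \<longlonglongrightarrow> (LBINT x. indicator {a<..b} x *\<^sub>R g x)"
  proof (rule integral_dominated_convergence[where w="\<lambda>x. \<bar>indicator {0<..} x * g x\<bar>"])
    show "integrable lborel (\<lambda>x. \<bar>indicator {0<..} x * g x\<bar>)"
      using int by (rule integrable_abs)
    have "(\<lambda>x. indicator {a<..b} x * (indicator {0<..} x * g x)) \<in> borel_measurable lborel"
      using int by measurable
    also have "(\<lambda>x. indicator {a<..b} x * (indicator {0<..} x * g x)) = (\<lambda>x. indicator {a<..b} x *\<^sub>R g x)"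
      using ab by (auto split: split_indicator)
    finally show "(\<lambda>x. indicator {a<..b} x *\<^sub>R g x) \<in> borel_measurable lborel" .
    show "(\<lambda>x. indicator {0<..} x *\<^sub>R (g x * \<phi> n x)) \<in> borel_measurable lborel" for n
    proof -
      have "\<phi> n \<in> borel_measurable borel"
        by (rule borel_measurable_continuous_onI) (rule smooth_fun_deriv(3)[OF smooth])
      then have "(\<lambda>x. (indicator {0<..} x * g x) * \<phi> n x) \<in> borel_measurable lborel"
        using int by measurable
      then show ?thesis by (simp add: mult.assoc)
    qed
    have "\<bar>\<phi> n x\<bar> \<le> 1" for n x
      using smooth_step_bounds[of "real (Suc n) * (x - a)"] smooth_step_bounds[of "real (Suc n) * (x - b)"]
      by (auto simp: \<phi>_def)
    then show "AE x in lborel. norm (indicator {0<..} x *\<^sub>R (g x * \<phi> n x)) \<le> \<bar>indicator {0<..} x * g x\<bar>" for n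
      by (intro always_eventually allI) (auto simp: abs_mult mult_left_le split: split_indicator)
    have eventually_1: "eventually (\<lambda>n. smooth_step (real (Suc n) * (x - c)) = 1) sequentially" if "x > c" for x c
    proof -
      obtain n0 where n0: "1 / (x - c) \<le> real n0" using real_arch_simple by blast
      have "smooth_step (real (Suc n) * (x - c)) = 1" if "n \<ge> n0" for n
      proof -
        have "1 / (x - c) \<le> real (Suc n)" using n0 that by linarith
        then have "1 \<le> real (Suc n) * (x - c)" using \<open>x > c\<close> by (simp add: pos_divide_le_eq)
        then show ?thesis by (rule smooth_step_ge_1)
      qed
      then show ?thesis by (auto simp: eventually_sequentially)
    qed
    have zero: "smooth_step (real (Suc n) * (x - c)) = 0" if "x \<le> c" for x c n
      using that by (intro smooth_step_le_0 mult_nonneg_nonpos) auto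
    have "eventually (\<lambda>n. indicator {a<..b} x *\<^sub>R g x = indicator {0<..} x *\<^sub>R (g x * \<phi> n x)) sequentially" for x
    proof -
      consider "x \<le> a" | "a < x" "x \<le> b" | "x > b" by linarith
      then show ?thesis
      proof cases
        case 1
        then show ?thesis using ab zero by (auto simp: \<phi>_def)
      next
        case 2
        then show ?thesis using ab zero eventually_1[of a x]
          by (auto simp: \<phi>_def elim: eventually_mono)
      next
        case 3
        then have "x > a" using ab by simp
        from eventually_1[OF this] eventually_1[OF 3] show ?thesis
          by eventually_elim (use ab 3 in \<open>simp add: \<phi>_def\<close>)
      qed
    qed
    then show "AE x in lborel. (\<lambda>n. indicator {0<..} x *\<^sub>R (g x * \<phi> n x)) \<longlonglongrightarrow> indicator {a<..b} x *\<^sub>R g x"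
      by (intro always_eventually allI) (rule Lim_transform_eventually[OF tendsto_const])
  qed
  with lim1 show ?thesis
    using LIMSEQ_unique by (auto simp: set_lebesgue_integral_def)
qed

text \<open>Test functions on the open half-line cannot reach the left endpoint 0. It is approached
  by positive points, using continuity of f at 0 on one side and integrability of g on the
  other.\<close>

lemma weak_derivative_FTC:
  fixes f g :: "real \<Rightarrow> real"
  assumes weak: "has_weak_derivative {0<..} f g" and f: "continuous_on {0..} f"
    and g: "set_integrable lborel {0<..} g" and ab: "0 \<le> a" "a \<le> b"
  shows "f b - f a = (LBINT x:{a<..b}. g x)"
proof (cases "a = 0 \<and> b > 0")
  case False
  then show ?thesis
    using weak_derivative_FTC_pos[OF weak f g, of a b] ab by (cases "a = 0") (auto simp: set_lebesgue_integral_def)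
next
  case True
  define t where "t n = b * inverse (real (Suc n))" for n
  have "(\<lambda>n. b * inverse (real (Suc n))) \<longlonglongrightarrow> b * 0"
    by (intro tendsto_intros LIMSEQ_inverse_real_of_nat)
  then have t0: "t \<longlonglongrightarrow> 0" by (simp add: t_def[abs_def])
  have t: "0 < t n" "t n \<le> b" for n
    using True by (auto simp: t_def field_simps)
  have int: "integrable lborel (\<lambda>x. indicator {0<..} x * g x)"
    using g by (simp add: set_integrable_def)
  have "(\<lambda>n. f b - f (t n)) \<longlonglongrightarrow> f b - f 0"
    using t by (intro tendsto_intros continuous_on_tendsto_compose[OF f t0]) (auto intro!: always_eventually less_imp_le)
  moreover have "f b - f (t n) = (LBINT x. indicator {t n<..b} x * (indicator {0<..} x * g x))" for n
    using weak_derivative_FTC_pos[OF weak f g t[of n]] t(1)[of n]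
    by (auto simp: set_lebesgue_integral_def intro!: Bochner_Integration.integral_cong split: split_indicator)
  moreover have "(\<lambda>n. LBINT x. indicator {t n<..b} x * (indicator {0<..} x * g x)) \<longlonglongrightarrow>
      (LBINT x. indicator {0<..b} x * (indicator {0<..} x * g x))"
  proof (rule integral_dominated_convergence[where w="\<lambda>x. \<bar>indicator {0<..} x * g x\<bar>"])
    show "integrable lborel (\<lambda>x. \<bar>indicator {0<..} x * g x\<bar>)"
      using int by (rule integrable_abs)
    show "(\<lambda>x. indicator {0<..b} x * (indicator {0<..} x * g x)) \<in> borel_measurable lborel"
      "(\<lambda>x. indicator {t n<..b} x * (indicator {0<..} x * g x)) \<in> borel_measurable lborel" for n
      using int by measurable
    show "AE x in lborel. norm (indicator {t n<..b} x * (indicator {0<..} x * g x)) \<le> \<bar>indicator {0<..} x * g x\<bar>" for n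
      by (intro always_eventually allI) (auto split: split_indicator)
    have "eventually (\<lambda>n. indicator {0<..b} x * (indicator {0<..} x * g x)
        = indicator {t n<..b} x * (indicator {0<..} x * g x)) sequentially" for x
    proof (cases "x > 0")
      case True
      then have "eventually (\<lambda>n. t n < x) sequentially"
        using t0 by (rule order_tendstoD(2)[rotated])
      then show ?thesis by eventually_elim (use True in \<open>auto split: split_indicator\<close>)
    qed simp
    then show "AE x in lborel. (\<lambda>n. indicator {t n<..b} x * (indicator {0<..} x * g x))
        \<longlonglongrightarrow> indicator {0<..b} x * (indicator {0<..} x * g x)"
      by (intro always_eventually allI) (rule Lim_transform_eventually[OF tendsto_const])
  qed
  ultimately have "f b - f 0 = (LBINT x. indicator {0<..b} x * (indicator {0<..} x * g x))"
    using LIMSEQ_unique by simp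
  also have "\<dots> = (LBINT x:{0<..b}. g x)"
    by (auto simp: set_lebesgue_integral_def intro!: Bochner_Integration.integral_cong split: split_indicator)
  finally show ?thesis using True by simp
qed

section \<open>Freezing an independent random variable\<close>

text \<open>Each \<open>Z t\<close> is independent of \<open>T\<close> separately, and only up to a
  null set; no joint law of the whole family with \<open>T\<close> is at hand to apply Fubini to.
  For a rounded \<open>T\<close> the claim is a finite sum of products; path continuity and one
  integrable bound carry it to the limit. \<open>Y\<close> stands for Z evaluated at T, whose
  measurability is thus a hypothesis.\<close>

lemma (in prob_space) indep_var_frozen_expectation:
  fixes Z :: "real \<Rightarrow> 'a \<Rightarrow> real" and T Y G :: "'a \<Rightarrow> real"
  assumes T [measurable]: "T \<in> borel_measurable M" and T_range: "\<And>\<omega>. \<omega> \<in> space M \<Longrightarrow> T \<omega> \<in> {0..b}"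
    and Z [measurable]: "\<And>t. t \<in> {0..b} \<Longrightarrow> Z t \<in> borel_measurable M"
    and indep: "\<And>t. t \<in> {0..b} \<Longrightarrow> \<exists>Z'. indep_var borel Z' borel T \<and> (AE \<omega> in M. Z t \<omega> = Z' \<omega>)"
    and cont: "AE \<omega> in M. continuous_on {0..b} (\<lambda>t. Z t \<omega>)"
    and G: "integrable M G" and dom: "AE \<omega> in M. \<forall>t\<in>{0..b}. \<bar>Z t \<omega>\<bar> \<le> G \<omega>"
    and Y [measurable]: "Y \<in> borel_measurable M" and Y_eq: "AE \<omega> in M. Y \<omega> = Z (T \<omega>) \<omega>"
  shows "integrable M Y" "integrable M (\<lambda>\<omega>. expectation (Z (T \<omega>)))"
    and "expectation Y = expectation (\<lambda>\<omega>. expectation (Z (T \<omega>)))"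
proof -
  define \<mu> where "\<mu> t = expectation (Z t)" for t
  \<comment> \<open>Rounding down to the mesh 1 / (n + 1) keeps the grid value inside {0..b} and
    leaves finitely many values, indexed by \<open>J n\<close>.\<close>
  define k where "k n \<omega> = nat \<lfloor>real (Suc n) * T \<omega>\<rfloor>" for n \<omega>
  define T' where "T' n \<omega> = real (k n \<omega>) / real (Suc n)" for n \<omega>
  define J where "J n = {..nat \<lfloor>real (Suc n) * b\<rfloor>}" for n
  have k [measurable]: "k n \<in> measurable M (count_space UNIV)" for n
    unfolding k_def by measurable
  have k_J: "k n \<omega> \<in> J n" if "\<omega> \<in> space M" for n \<omega>
    unfolding k_def J_def using T_range[OF that] by (auto intro!: nat_mono floor_mono)
  have J_range: "real j / real (Suc n) \<in> {0..b}" if "j \<in> J n" "b \<ge> 0" for j n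
  proof -
    have "real j \<le> real_of_int \<lfloor>real (Suc n) * b\<rfloor>"
      using that by (simp add: J_def le_nat_iff)
    also have "\<dots> \<le> real (Suc n) * b" by simp
    finally show ?thesis by (simp add: field_simps)
  qed
  have b: "b \<ge> 0"
    using not_empty T_range by fastforce
  have T'_range: "T' n \<omega> \<in> {0..b}" if "\<omega> \<in> space M" for n \<omega>
    using J_range[OF k_J[OF that] b] by (simp add: T'_def)
  have T'_lim: "(\<lambda>n. T' n \<omega>) \<longlonglongrightarrow> T \<omega>" if "\<omega> \<in> space M" for \<omega>
  proof (rule real_tendsto_sandwich)
    have *: "real (k n \<omega>) \<le> real (Suc n) * T \<omega>" "real (Suc n) * T \<omega> - 1 \<le> real (k n \<omega>)" for n
      using T_range[OF that] unfolding k_def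
      by (auto simp del: of_nat_Suc)
    show "eventually (\<lambda>n. T \<omega> - inverse (real (Suc n)) \<le> T' n \<omega>) sequentially"
    proof (intro always_eventually allI)
      fix n
      have "T \<omega> - 1 / real (Suc n) = (real (Suc n) * T \<omega> - 1) / real (Suc n)"
        by (simp add: diff_divide_distrib del: of_nat_Suc)
      also have "\<dots> \<le> T' n \<omega>"
        unfolding T'_def using *(2)[of n] by (intro divide_right_mono) auto
      finally show "T \<omega> - inverse (real (Suc n)) \<le> T' n \<omega>" by (simp add: divide_inverse)
    qed
    show "eventually (\<lambda>n. T' n \<omega> \<le> T \<omega>) sequentially"
      using *(1) by (auto simp: T'_def field_simps simp del: of_nat_Suc)
    have "(\<lambda>n. T \<omega> - inverse (real (Suc n))) \<longlonglongrightarrow> T \<omega> - 0"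
      by (intro tendsto_intros LIMSEQ_inverse_real_of_nat)
    then show "(\<lambda>n. T \<omega> - inverse (real (Suc n))) \<longlonglongrightarrow> T \<omega>" by simp
  qed simp
  have Z_int: "integrable M (Z t)" if "t \<in> {0..b}" for t
  proof (rule Bochner_Integration.integrable_bound[OF G Z[OF that]])
    show "AE \<omega> in M. norm (Z t \<omega>) \<le> norm (G \<omega>)"
      using dom by eventually_elim (use that in \<open>auto intro: order_trans[OF _ abs_ge_self]\<close>)
  qed
  have \<mu>_bound: "\<bar>\<mu> t\<bar> \<le> expectation G" if "t \<in> {0..b}" for t
  proof -
    have "\<bar>\<mu> t\<bar> \<le> expectation (\<lambda>\<omega>. \<bar>Z t \<omega>\<bar>)"
      unfolding \<mu>_def by (rule integral_abs_bound)
    also have "\<dots> \<le> expectation G"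
      using Z_int[OF that] G dom that by (intro integral_mono_AE) (auto elim: eventually_mono)
    finally show ?thesis .
  qed
  have \<mu>_lim: "(\<lambda>n. \<mu> (t n)) \<longlonglongrightarrow> \<mu> t0" if t: "t \<longlonglongrightarrow> t0" "\<And>n. t n \<in> {0..b}" "t0 \<in> {0..b}" for t t0
    unfolding \<mu>_def
  proof (rule integral_dominated_convergence[where w=G])
    show "AE \<omega> in M. (\<lambda>n. Z (t n) \<omega>) \<longlonglongrightarrow> Z t0 \<omega>"
      using cont by eventually_elim (use t in \<open>auto intro: continuous_on_tendsto_compose\<close>)
    show "AE \<omega> in M. norm (Z (t n) \<omega>) \<le> G \<omega>" for n
      using dom by eventually_elim (use t in auto)
  qed (use G t Z in auto)

  define Yn where "Yn n \<omega> = (\<Sum>j\<in>J n. Z (real j / real (Suc n)) \<omega> * indicator {j} (k n \<omega>))" for n \<omega>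
  have Yn_eq: "Yn n \<omega> = Z (T' n \<omega>) \<omega>" if "\<omega> \<in> space M" for n \<omega>
  proof -
    have "Yn n \<omega> = (\<Sum>j\<in>J n. if k n \<omega> = j then Z (real j / real (Suc n)) \<omega> else 0)"
      unfolding Yn_def by (intro sum.cong) (auto split: split_indicator)
    then show ?thesis using k_J[OF that] by (simp add: T'_def J_def)
  qed
  have \<mu>_eq: "\<mu> (T' n \<omega>) = (\<Sum>j\<in>J n. \<mu> (real j / real (Suc n)) * indicator {j} (k n \<omega>))"
    if "\<omega> \<in> space M" for n \<omega>
  proof -
    have "(\<Sum>j\<in>J n. \<mu> (real j / real (Suc n)) * indicator {j} (k n \<omega>)) =
        (\<Sum>j\<in>J n. if k n \<omega> = j then \<mu> (real j / real (Suc n)) else 0)"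
      by (intro sum.cong) (auto split: split_indicator)
    then show ?thesis using k_J[OF that] by (simp add: T'_def J_def)
  qed
  have [measurable]: "(\<lambda>\<omega>. indicator {j} (k n \<omega>) :: real) \<in> borel_measurable M" for j n
    by (rule measurable_compose[OF k]) simp
  have ind_int: "integrable M (\<lambda>\<omega>. indicator {j} (k n \<omega>) :: real)" for j n
    by (rule integrable_const_bound[where B=1]) auto
  \<comment> \<open>The grid indicator is a function of \<open>T\<close>, hence independent of the
    modification \<open>Z'\<close> of Z at the grid point, and the expectation factors.\<close>
  have split: "integrable M (\<lambda>\<omega>. Z (real j / real (Suc n)) \<omega> * indicator {j} (k n \<omega>))"
    "expectation (\<lambda>\<omega>. Z (real j / real (Suc n)) \<omega> * indicator {j} (k n \<omega>)) =
      \<mu> (real j / real (Suc n)) * expectation (\<lambda>\<omega>. indicator {j} (k n \<omega>))" if "j \<in> J n" for j n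
  proof -
    define t where "t = real j / real (Suc n)"
    have t: "t \<in> {0..b}" unfolding t_def by (rule J_range[OF that b])
    obtain Z' where Z': "indep_var borel Z' borel T" "AE \<omega> in M. Z t \<omega> = Z' \<omega>"
      using indep[OF t] by blast
    have [measurable]: "Z' \<in> borel_measurable M"
      using Z'(1) by (rule indep_var_rv1)
    have [measurable]: "Z t \<in> borel_measurable M" by (rule Z[OF t])
    have Z'_int: "integrable M Z'"
      using Z_int[OF t] Z'(2) by (subst integrable_cong_AE[where g="Z t"]) auto
    have E: "expectation Z' = \<mu> t"
      unfolding \<mu>_def using Z'(2) by (intro integral_cong_AE) auto
    have "indep_var borel (id \<circ> Z') borel ((\<lambda>x. indicator {j} (nat \<lfloor>real (Suc n) * x\<rfloor>)) \<circ> T)"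
      using Z'(1) by (rule indep_var_compose) measurable
    then have iv: "indep_var borel Z' borel (\<lambda>\<omega>. indicator {j} (k n \<omega>) :: real)"
      by (simp add: comp_def k_def)
    have AE: "AE \<omega> in M. Z t \<omega> * indicator {j} (k n \<omega>) = Z' \<omega> * indicator {j} (k n \<omega>)"
      using Z'(2) by eventually_elim auto
    show "integrable M (\<lambda>\<omega>. Z (real j / real (Suc n)) \<omega> * indicator {j} (k n \<omega>))"
      unfolding t_def[symmetric] using indep_var_integrable[OF iv Z'_int ind_int] AE by (subst integrable_cong_AE) auto
    show "expectation (\<lambda>\<omega>. Z (real j / real (Suc n)) \<omega> * indicator {j} (k n \<omega>)) =
        \<mu> (real j / real (Suc n)) * expectation (\<lambda>\<omega>. indicator {j} (k n \<omega>))"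
      unfolding t_def[symmetric] using indep_var_lebesgue_integral[OF iv Z'_int ind_int] integral_cong_AE[OF _ _ AE] E by auto
  qed
  have step: "expectation (Yn n) = expectation (\<lambda>\<omega>. \<mu> (T' n \<omega>))" for n
  proof -
    have "expectation (\<lambda>\<omega>. \<mu> (T' n \<omega>)) =
        expectation (\<lambda>\<omega>. \<Sum>j\<in>J n. \<mu> (real j / real (Suc n)) * indicator {j} (k n \<omega>))"
      by (intro Bochner_Integration.integral_cong \<mu>_eq) auto
    also have "\<dots> = (\<Sum>j\<in>J n. \<mu> (real j / real (Suc n)) * expectation (\<lambda>\<omega>. indicator {j} (k n \<omega>)))"
      using ind_int by (subst Bochner_Integration.integral_sum) auto
    also have "\<dots> = expectation (Yn n)"
      unfolding Yn_def using split by (subst Bochner_Integration.integral_sum) auto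
    finally show ?thesis by simp
  qed
  have \<mu>T'_meas: "(\<lambda>\<omega>. \<mu> (T' n \<omega>)) \<in> borel_measurable M" for n
    by (subst measurable_cong[OF \<mu>_eq]) measurable
  have Yn_meas: "Yn n \<in> borel_measurable M" for n
    unfolding Yn_def[abs_def] using split(1) by (intro borel_measurable_sum) auto
  have \<mu>T_meas: "(\<lambda>\<omega>. \<mu> (T \<omega>)) \<in> borel_measurable M"
    by (rule borel_measurable_LIMSEQ_real[OF _ \<mu>T'_meas])
       (use T'_lim T'_range T_range in \<open>auto intro!: \<mu>_lim\<close>)
  have Y_dom: "AE \<omega> in M. norm (Y \<omega>) \<le> norm (G \<omega>)"
    using Y_eq dom AE_space by eventually_elim (use T_range in fastforce)
  show "integrable M Y"
    by (rule Bochner_Integration.integrable_bound[OF G Y Y_dom])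
  show "integrable M (\<lambda>\<omega>. expectation (Z (T \<omega>)))"
    using \<mu>T_meas \<mu>_bound T_range unfolding \<mu>_def[symmetric]
    by (intro integrable_const_bound[where B="expectation G"]) auto
  have lim1: "(\<lambda>n. expectation (Yn n)) \<longlonglongrightarrow> expectation Y"
  proof (rule integral_dominated_convergence[where w=G])
    show "AE \<omega> in M. (\<lambda>n. Yn n \<omega>) \<longlonglongrightarrow> Y \<omega>"
      using cont Y_eq AE_space
    proof eventually_elim
      case (elim \<omega>)
      then have "(\<lambda>n. Z (T' n \<omega>) \<omega>) \<longlonglongrightarrow> Z (T \<omega>) \<omega>"
        using T'_lim T'_range T_range by (intro continuous_on_tendsto_compose[OF elim(1)]) auto
      then show ?case using elim by (simp add: Yn_eq)
    qed
    show "AE \<omega> in M. norm (Yn n \<omega>) \<le> G \<omega>" for n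
      using dom AE_space by eventually_elim (use T'_range in \<open>auto simp: Yn_eq\<close>)
  qed (use G Yn_meas in auto)
  have lim2: "(\<lambda>n. expectation (\<lambda>\<omega>. \<mu> (T' n \<omega>))) \<longlonglongrightarrow> expectation (\<lambda>\<omega>. \<mu> (T \<omega>))"
  proof (rule integral_dominated_convergence[where w="\<lambda>_. expectation G"])
    show "AE \<omega> in M. (\<lambda>n. \<mu> (T' n \<omega>)) \<longlonglongrightarrow> \<mu> (T \<omega>)"
      using T'_lim T'_range T_range by (intro AE_I2 \<mu>_lim) auto
    show "AE \<omega> in M. norm (\<mu> (T' n \<omega>)) \<le> expectation G" for n
      using T'_range \<mu>_bound by (intro AE_I2) auto
  qed (use \<mu>T_meas \<mu>T'_meas in auto)
  show "expectation Y = expectation (\<lambda>\<omega>. expectation (Z (T \<omega>)))"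
    using LIMSEQ_unique[OF lim1] lim2 unfolding step \<mu>_def by auto
qed

section \<open>Transfer of independence, and the exponentially distributed level\<close>

lemma (in prob_space) indep_rvs_compose:
  assumes indep: "indep_rvs M A Y B Z"
    and f: "f \<in> measurable (vimage_algebra (space M) Y A) S" and h: "h \<in> measurable B T"
  shows "indep_var S f T (\<lambda>\<omega>. h (Z \<omega>))"
proof -
  let ?V = "vimage_algebra (space M) Y A" and ?W = "vimage_algebra (space M) Z B"
  from indep have YZ: "Y \<in> measurable M A" "Z \<in> measurable M B" and ind: "indep_set (sets ?V) (sets ?W)"
    by (auto simp: indep_rvs_def)
  have V: "sets ?V \<subseteq> events" using ind by (simp add: indep_sets2_eq)
  \<comment> \<open>Here f need not be given as a function of \<open>Y\<close>; measurability for
    the sigma-algebra generated by \<open>Y\<close> suffices. This covers limits of functions built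
    inside that sigma-algebra.\<close>
  have f_sets: "f -` C \<inter> space M \<in> sets ?V" if "C \<in> sets S" for C
    using measurable_sets[OF f that] by simp
  have hZ: "(\<lambda>\<omega>. h (Z \<omega>)) \<in> measurable ?W T"
    using measurable_compose[OF measurable_vimage_algebra1 h] YZ(2) by (auto simp: measurable_def)
  have h_sets: "(\<lambda>\<omega>. h (Z \<omega>)) -` C \<inter> space M \<in> sets ?W" if "C \<in> sets T" for C
    using measurable_sets[OF hZ that] by simp
  have "sigma_sets (space M) {f -` C \<inter> space M |C. C \<in> sets S} \<subseteq> sets ?V"
    using sets.sigma_sets_subset[of "{f -` C \<inter> space M |C. C \<in> sets S}" ?V] f_sets by auto
  moreover have "sigma_sets (space M) {(\<lambda>\<omega>. h (Z \<omega>)) -` C \<inter> space M |C. C \<in> sets T} \<subseteq> sets ?W"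
    using sets.sigma_sets_subset[of "{(\<lambda>\<omega>. h (Z \<omega>)) -` C \<inter> space M |C. C \<in> sets T}" ?W] h_sets by auto
  ultimately have "indep_set (sigma_sets (space M) {f -` C \<inter> space M |C. C \<in> sets S})
      (sigma_sets (space M) {(\<lambda>\<omega>. h (Z \<omega>)) -` C \<inter> space M |C. C \<in> sets T})"
    using ind unfolding indep_sets2_eq by blast
  moreover have "random_variable S f"
    using f V f_sets by (auto simp: measurable_def)
  moreover have "random_variable T (\<lambda>\<omega>. h (Z \<omega>))"
    using measurable_compose[OF YZ(2) h] .
  ultimately show ?thesis
    by (simp add: indep_var_eq)
qed

text \<open>A law with a density has no atoms, so the strict tail probability is also the non-strict
  one.\<close>

lemma (in prob_space) exponential_distributedD_ge:
  assumes D: "distributed M lborel L (exponential_density r)" and "0 \<le> a" "0 < r"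
  shows "prob {\<omega> \<in> space M. a \<le> L \<omega>} = exp (- r * a)"
proof -
  have L [measurable]: "L \<in> borel_measurable M"
    using distributed_measurable[OF D] by simp
  have "emeasure M (L -` {a} \<inter> space M) = (\<integral>\<^sup>+x. ennreal (exponential_density r x) * indicator {a} x \<partial>lborel)"
    using D by (intro distributed_emeasure) auto
  also have "\<dots> = 0"
    by (intro nn_integral_null_set finite_imp_null_set_lborel) auto
  finally have "L -` {a} \<inter> space M \<in> null_sets M"
    by (auto simp: null_sets_def)
  from AE_not_in[OF this] AE_space have "AE \<omega> in M. L \<omega> \<noteq> a"
    by eventually_elim auto
  then have "prob {\<omega> \<in> space M. a \<le> L \<omega>} = prob {\<omega> \<in> space M. a < L \<omega>}"
    by (intro finite_measure_eq_AE) (auto elim!: eventually_mono)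
  then show ?thesis
    using exponential_distributedD_gt[OF assms] by (simp add: mult.commute)
qed

lemma (in prob_space) exponential_distributed_nonneg:
  assumes D: "distributed M lborel L (exponential_density r)" and "0 < r"
  shows "AE \<omega> in M. 0 \<le> L \<omega>"
proof -
  have [measurable]: "L \<in> borel_measurable M"
    using distributed_measurable[OF D] by simp
  show ?thesis
    using exponential_distributedD_ge[OF D, of 0] assms(2) prob_Collect_eq_1[of "\<lambda>\<omega>. 0 \<le> L \<omega>"]
    by simp
qed

text \<open>Fubini, with the survival probability exp (- r l) as the inner expectation. Mean, second
  moment and cost all pass through this identity, each with its own h.\<close>

lemma (in prob_space) exponential_distributed_truncated_integral:
  fixes h :: "real \<Rightarrow> real"
  assumes D: "distributed M lborel L (exponential_density r)" and r: "0 < r"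
    and h: "set_integrable lborel {0..b} h"
  shows "integrable M (\<lambda>\<omega>. LBINT l:{0..b}. h l * indicator {0..L \<omega>} l)"
    and "expectation (\<lambda>\<omega>. LBINT l:{0..b}. h l * indicator {0..L \<omega>} l) = (LBINT l:{0..b}. h l * exp (- r * l))"
proof -
  have L [measurable]: "L \<in> borel_measurable M"
    using distributed_measurable[OF D] by simp
  interpret LM: pair_sigma_finite lborel M ..
  let ?h = "\<lambda>l. indicator {0..b} l * h l"
  have h' [measurable]: "?h \<in> borel_measurable lborel" and h_int: "integrable lborel ?h"
    using h by (auto simp: set_integrable_def)
  define g where "g l \<omega> = ?h l * indicator {0..L \<omega>} l" for l \<omega>
  have [measurable]: "(\<lambda>(l, \<omega>). g l \<omega>) \<in> borel_measurable (lborel \<Otimes>\<^sub>M M)"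
  proof -
    have "(\<lambda>(l, \<omega>). ?h l * (if 0 \<le> l \<and> l \<le> L \<omega> then 1 else 0)) \<in> borel_measurable (lborel \<Otimes>\<^sub>M M)"
      by measurable
    also have "(\<lambda>(l, \<omega>). ?h l * (if 0 \<le> l \<and> l \<le> L \<omega> then 1 else 0)) = (\<lambda>(l, \<omega>). g l \<omega>)"
      by (auto simp: g_def split: split_indicator)
    finally show ?thesis .
  qed
  have int: "integrable (lborel \<Otimes>\<^sub>M M) (\<lambda>(l, \<omega>). g l \<omega>)"
  proof (rule Bochner_Integration.integrable_bound)
    show "integrable (lborel \<Otimes>\<^sub>M M) (\<lambda>(l, \<omega>). ?h l)"
    proof (subst LM.integrable_product_swap_iff[symmetric], simp add: split_beta')
      have "integrable (lborel \<Otimes>\<^sub>M M) (\<lambda>p. ?h (fst p))"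
        using LM.integrable_fst'
        by (intro LM.Fubini_integrable) (auto simp: prob_space h_int intro!: integrable_abs)
      then show "integrable (M \<Otimes>\<^sub>M lborel) (\<lambda>p. ?h (snd p))"
        by (subst (asm) LM.integrable_product_swap_iff[symmetric]) (simp add: split_beta')
    qed
    show "(\<lambda>(l, \<omega>). g l \<omega>) \<in> borel_measurable (lborel \<Otimes>\<^sub>M M)" by measurable
  qed (auto simp: g_def split: split_indicator)
  have set_eq: "(LBINT l:{0..b}. h l * indicator {0..L \<omega>} l) = (LBINT l. g l \<omega>)" for \<omega>
    by (simp add: g_def set_lebesgue_integral_def mult.assoc)
  show "integrable M (\<lambda>\<omega>. LBINT l:{0..b}. h l * indicator {0..L \<omega>} l)"
    unfolding set_eq by (rule LM.integrable_snd[OF int])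
  have "expectation (\<lambda>\<omega>. LBINT l:{0..b}. h l * indicator {0..L \<omega>} l) = (LBINT l. expectation (\<lambda>\<omega>. g l \<omega>))"
    unfolding set_eq by (rule LM.Fubini_integral[OF int])
  also have "\<dots> = (LBINT l. ?h l * exp (- r * l))"
  proof (intro Bochner_Integration.integral_cong refl)
    fix l
    show "expectation (\<lambda>\<omega>. g l \<omega>) = ?h l * exp (- r * l)"
    proof (cases "l \<in> {0..b}")
      case True
      have "expectation (\<lambda>\<omega>. g l \<omega>) = expectation (\<lambda>\<omega>. ?h l * indicator {\<omega> \<in> space M. l \<le> L \<omega>} \<omega>)"
        using True by (intro Bochner_Integration.integral_cong) (auto simp: g_def split: split_indicator)
      also have "\<dots> = ?h l * expectation (\<lambda>\<omega>. indicator {\<omega> \<in> space M. l \<le> L \<omega>} \<omega>)"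
        by (rule integral_mult_right_zero)
      also have "expectation (\<lambda>\<omega>. indicator {\<omega> \<in> space M. l \<le> L \<omega>} \<omega>) = exp (- r * l)"
        using exponential_distributedD_ge[OF D _ r, of l] True by simp
      finally show ?thesis .
    qed (simp add: g_def)
  qed
  finally show "expectation (\<lambda>\<omega>. LBINT l:{0..b}. h l * indicator {0..L \<omega>} l) = (LBINT l:{0..b}. h l * exp (- r * l))"
    by (simp add: set_lebesgue_integral_def mult.assoc)
qed

section \<open>Processes with exponentially decaying second moments\<close>

lemma LBINT_exp_Icc:
  fixes a :: real
  assumes "a \<noteq> 0" "0 \<le> b"
  shows "(LBINT l:{0..b}. exp (a * l)) = (exp (a * b) - 1) / a"
proof -
  have "(LBINT l:{0..b}. exp (a * l)) = exp (a * b) / a - exp (a * 0) / a"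
    unfolding set_lebesgue_integral_def
  proof (rule integral_FTC_atLeastAtMost[OF assms(2), where F="\<lambda>l. exp (a * l) / a"])
    show "((\<lambda>l. exp (a * l) / a) has_vector_derivative exp (a * x)) (at x within {0..b})" for x
      unfolding has_real_derivative_iff_has_vector_derivative[symmetric]
      using assms(1) by (auto intro!: derivative_eq_intros)
  qed (intro continuous_intros)
  then show ?thesis by (simp add: diff_divide_distrib)
qed

lemma nn_integral_exp_Icc_le:
  fixes s :: real
  assumes "s > 0" "0 \<le> t"
  shows "(\<integral>\<^sup>+l. ennreal (exp (s * l)) * indicator {0..t} l \<partial>lborel) \<le> ennreal (exp (s * t) / s)"
proof -
  have "(\<integral>\<^sup>+l. ennreal (exp (s * l)) * indicator {0..t} l \<partial>lborel) = exp (s * t) / s - exp (s * 0) / s"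
    using assms by (intro nn_integral_FTC_Icc) (auto intro!: derivative_eq_intros)
  also have "\<dots> \<le> ennreal (exp (s * t) / s)"
    using assms by (intro ennreal_leI) auto
  finally show ?thesis .
qed

text \<open>On one cell the weight varies by at most exp (r b) - exp (r a) = exp (r a) (exp (r h) -
  1). Bounding exp (r a) by exp (r t), with t fixed throughout the induction, gives all cells the
  same factor, so the errors add up to a multiple of the integral of |d|.\<close>

lemma riemann_stieltjes_step_bound:
  fixes d :: "real \<Rightarrow> real"
  assumes d: "integrable lborel d" and "0 \<le> r" "0 \<le> h" "real k * h \<le> t"
  shows "\<bar>(\<Sum>i<k. exp (r * (real i * h)) * (LBINT l:{real i * h<..real (Suc i) * h}. d l))
      - (LBINT l:{0<..real k * h}. exp (r * l) * d l)\<bar>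
    \<le> exp (r * t) * (exp (r * h) - 1) * (LBINT l:{0<..real k * h}. \<bar>d l\<bar>)"
  using assms(4)
proof (induction k)
  case 0
  show ?case by (simp add: set_lebesgue_integral_def)
next
  case (Suc k)
  define a b where "a = real k * h" and "b = real (Suc k) * h"
  have ab: "0 \<le> a" "a \<le> b" "b \<le> t" "b = a + h"
    using assms(3) Suc.prems by (auto simp: a_def b_def algebra_simps)
  have un: "{0<..b} = {0<..a} \<union> {a<..b}" and disj: "{0<..a} \<inter> {a<..b} = {}"
    using ab by auto
  have d_int: "set_integrable lborel {x<..y} d" for x y
    unfolding set_integrable_def using d by (intro integrable_mult_indicator) auto
  have abs_int: "set_integrable lborel {x<..y} (\<lambda>l. \<bar>d l\<bar>)" for x y
    using d_int set_integrable_abs by blast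
  have e_int: "set_integrable lborel {x<..y} (\<lambda>l. exp (r * l) * d l)" for x y
    unfolding set_integrable_def
  proof (rule Bochner_Integration.integrable_bound)
    show "integrable lborel (\<lambda>l. exp (r * y) * d l)"
      using d by simp
    show "(\<lambda>l. indicat_real {x<..y} l *\<^sub>R (exp (r * l) * d l)) \<in> borel_measurable lborel"
      using d by measurable
    show "AE l in lborel. norm (indicat_real {x<..y} l *\<^sub>R (exp (r * l) * d l)) \<le> norm (exp (r * y) * d l)"
      using assms(2) by (intro AE_I2) (auto simp: abs_mult mult_left_mono intro!: mult_right_mono split: split_indicator)
  qed
  have "exp (r * a) * (LBINT l:{a<..b}. d l) - (LBINT l:{a<..b}. exp (r * l) * d l)
      = (LBINT l:{a<..b}. exp (r * a) * d l - exp (r * l) * d l)"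
    using d_int e_int by (subst set_integral_diff) (auto simp: set_integral_mult_right set_integrable_mult_right)
  also have "\<bar>\<dots>\<bar> \<le> (LBINT l:{a<..b}. \<bar>exp (r * a) * d l - exp (r * l) * d l\<bar>)"
    using set_integral_norm_bound[of lborel "{a<..b}" "\<lambda>l. exp (r * a) * d l - exp (r * l) * d l"] d_int e_int
    by (auto simp: set_integral_diff set_integrable_mult_right)
  also have "\<dots> \<le> (LBINT l:{a<..b}. exp (r * t) * (exp (r * h) - 1) * \<bar>d l\<bar>)"
  proof (rule set_integral_mono)
    fix l assume l: "l \<in> {a<..b}"
    have "\<bar>exp (r * a) - exp (r * l)\<bar> \<le> exp (r * b) - exp (r * a)"
    proof -
      have "exp (r * a) \<le> exp (r * l)" "exp (r * l) \<le> exp (r * b)"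
        using l assms(2) by (auto intro!: mult_left_mono)
      then show ?thesis by linarith
    qed
    also have "\<dots> = exp (r * a) * (exp (r * h) - 1)"
      by (simp add: ab(4) algebra_simps exp_add)
    also have "\<dots> \<le> exp (r * t) * (exp (r * h) - 1)"
      using ab assms(2,3) by (intro mult_right_mono) (auto intro!: mult_left_mono)
    finally have "\<bar>exp (r * a) - exp (r * l)\<bar> * \<bar>d l\<bar> \<le> exp (r * t) * (exp (r * h) - 1) * \<bar>d l\<bar>"
      by (intro mult_right_mono) auto
    then show "\<bar>exp (r * a) * d l - exp (r * l) * d l\<bar> \<le> exp (r * t) * (exp (r * h) - 1) * \<bar>d l\<bar>"
      by (simp add: abs_mult[symmetric] left_diff_distrib)
  qed (use d_int e_int abs_int in \<open>auto intro!: set_integrable_abs set_integral_diff set_integrable_mult_right\<close>)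
  also have "\<dots> = exp (r * t) * (exp (r * h) - 1) * (LBINT l:{a<..b}. \<bar>d l\<bar>)"
    by (simp add: set_integral_mult_right)
  finally have last: "\<bar>exp (r * a) * (LBINT l:{a<..b}. d l) - (LBINT l:{a<..b}. exp (r * l) * d l)\<bar>
      \<le> exp (r * t) * (exp (r * h) - 1) * (LBINT l:{a<..b}. \<bar>d l\<bar>)" .
  have "\<bar>(\<Sum>i<k. exp (r * (real i * h)) * (LBINT l:{real i * h<..real (Suc i) * h}. d l))
      - (LBINT l:{0<..a}. exp (r * l) * d l)\<bar>
    \<le> exp (r * t) * (exp (r * h) - 1) * (LBINT l:{0<..a}. \<bar>d l\<bar>)"
    unfolding a_def using ab by (intro Suc.IH) (simp add: a_def)
  with last show ?case
    unfolding b_def[symmetric] un set_integral_Un[OF disj abs_int abs_int] set_integral_Un[OF disj e_int e_int]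
      sum.lessThan_Suc
    by (simp only: a_def[symmetric] b_def[symmetric] distrib_left)
qed

text \<open>The error factor exp (r h) - 1 vanishes with the mesh. The sums involve d only through
  its integrals over cells, that is, through increments of an antiderivative.\<close>

lemma riemann_stieltjes_exp_tendsto:
  fixes d :: "real \<Rightarrow> real"
  assumes d: "integrable lborel d" and "0 \<le> r" "0 \<le> t"
  defines "h \<equiv> \<lambda>n. t / real (Suc n)"
  shows "(\<lambda>n. \<Sum>i<Suc n. exp (r * (real i * h n)) * (LBINT l:{real i * h n<..real (Suc i) * h n}. d l))
    \<longlonglongrightarrow> (LBINT l:{0<..t}. exp (r * l) * d l)"
proof -
  have hn: "real (Suc n) * h n = t" "0 \<le> h n" for n
    using assms(3) by (auto simp: h_def simp del: of_nat_Suc)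
  have "(\<lambda>n. t * inverse (real (Suc n))) \<longlonglongrightarrow> t * 0"
    by (intro tendsto_intros LIMSEQ_inverse_real_of_nat)
  then have h0: "h \<longlonglongrightarrow> 0" by (simp add: h_def[abs_def] divide_inverse)
  have "(\<lambda>n. exp (r * t) * (exp (r * h n) - 1) * (LBINT l:{0<..t}. \<bar>d l\<bar>)) \<longlonglongrightarrow>
      exp (r * t) * (exp (r * 0) - 1) * (LBINT l:{0<..t}. \<bar>d l\<bar>)"
    by (intro tendsto_intros h0)
  then have lim0: "(\<lambda>n. exp (r * t) * (exp (r * h n) - 1) * (LBINT l:{0<..t}. \<bar>d l\<bar>)) \<longlonglongrightarrow> 0"
    by simp
  have "\<bar>(\<Sum>i<Suc n. exp (r * (real i * h n)) * (LBINT l:{real i * h n<..real (Suc i) * h n}. d l))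
      - (LBINT l:{0<..t}. exp (r * l) * d l)\<bar> \<le> exp (r * t) * (exp (r * h n) - 1) * (LBINT l:{0<..t}. \<bar>d l\<bar>)" for n
    using riemann_stieltjes_step_bound[OF d assms(2) hn(2), of "Suc n" n t]
    by (simp only: hn(1) order_refl)
  then have "(\<lambda>n. (\<Sum>i<Suc n. exp (r * (real i * h n)) * (LBINT l:{real i * h n<..real (Suc i) * h n}. d l))
      - (LBINT l:{0<..t}. exp (r * l) * d l)) \<longlonglongrightarrow> 0"
    by (intro Lim_null_comparison[OF _ lim0] always_eventually allI) (simp only: real_norm_def)
  then show ?thesis by (rule LIM_zero_cancel)
qed

text \<open>\<open>D\<close> is the derivative extended by zero, so that Fubini can be applied on
  the whole line; weights then have to be bounded at positive levels only. Stating
  \<open>D_L2\<close> as a nonnegative integral includes the finiteness of the moment.\<close>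

locale decaying_process = prob_space M for M :: "'a measure" +
  fixes D :: "real \<Rightarrow> 'a \<Rightarrow> real" and K \<beta> :: real
  assumes D_meas [measurable]: "(\<lambda>(l, \<omega>). D l \<omega>) \<in> borel_measurable (lborel \<Otimes>\<^sub>M M)"
    and D_nonpos [simp]: "l \<le> 0 \<Longrightarrow> D l \<omega> = 0"
    and D_L2: "l > 0 \<Longrightarrow> (\<integral>\<^sup>+\<omega>. ennreal ((D l \<omega>)\<^sup>2) \<partial>M) \<le> ennreal (K\<^sup>2 * exp (- \<beta> * l))"
    and K: "0 \<le> K" and \<beta>: "0 < \<beta>"
begin

sublocale LM: pair_sigma_finite lborel M ..

lemma D_meas_swap [measurable]: "(\<lambda>(\<omega>, l). D l \<omega>) \<in> borel_measurable (M \<Otimes>\<^sub>M lborel)"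
  using measurable_pair_swap[OF D_meas] by (simp add: split_beta')

lemma expectation_D_nonpos:
  assumes "l \<le> 0"
  shows "expectation (D l) = 0"
proof -
  have "D l = (\<lambda>\<omega>. 0)" using assms by auto
  then show ?thesis by simp
qed

text \<open>Split the integrand as exp (s l / 2) times exp ((r - s / 2) l) |D| and apply
  Cauchy-Schwarz: the first factor contributes A, the integral of exp (s l). The second has
  expectation at most K^2 times the integral of exp ((2 r - s - \<beta>) l), and the hypothesis on s
  says exactly 2 r - s - \<beta> \<le> s, so it is at most K^2 A.\<close>

lemma nn_integral_weighted_square:
  assumes s: "0 < s" "2 * r - \<beta> \<le> 2 * s" and t: "0 \<le> t"
  shows "(\<integral>\<^sup>+\<omega>. (\<integral>\<^sup>+l. ennreal (exp (r * l) * \<bar>D l \<omega>\<bar>) * indicator {0..t} l \<partial>lborel)\<^sup>2 \<partial>M)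
    \<le> ennreal ((K * exp (s * t) / s)\<^sup>2)"
proof -
  define A where "A = (\<integral>\<^sup>+l. ennreal (exp (s * l)) * indicator {0..t} l \<partial>lborel)"
  define B where "B \<omega> = (\<integral>\<^sup>+l. ennreal (exp ((2 * r - s) * l) * (D l \<omega>)\<^sup>2) * indicator {0..t} l \<partial>lborel)" for \<omega>
  have A_le: "A \<le> ennreal (exp (s * t) / s)"
    unfolding A_def using s t by (intro nn_integral_exp_Icc_le)
  have pw: "(\<integral>\<^sup>+l. ennreal (exp (r * l) * \<bar>D l \<omega>\<bar>) * indicator {0..t} l \<partial>lborel)\<^sup>2 \<le> A * B \<omega>"
    if "\<omega> \<in> space M" for \<omega>
  proof -
    have [measurable]: "(\<lambda>l. D l \<omega>) \<in> borel_measurable lborel"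
      using measurable_compose[OF measurable_Pair1'[OF that] D_meas_swap] by simp
    define f where "f l = ennreal (exp (s / 2 * l)) * indicator {0..t} l" for l
    define g where "g l = ennreal (exp ((r - s / 2) * l) * \<bar>D l \<omega>\<bar>) * indicator {0..t} l" for l
    have [measurable]: "f \<in> borel_measurable lborel" "g \<in> borel_measurable lborel"
      unfolding f_def g_def by measurable
    have fg: "f l * g l = ennreal (exp (r * l) * \<bar>D l \<omega>\<bar>) * indicator {0..t} l" for l
      by (auto simp: f_def g_def ennreal_mult'[symmetric] exp_add[symmetric] algebra_simps split: split_indicator)
    have f2: "f l ^ 2 = ennreal (exp (s * l)) * indicator {0..t} l" for l
      by (auto simp: f_def power2_eq_square ennreal_mult'[symmetric] exp_add[symmetric] split: split_indicator)
    have g2: "g l ^ 2 = ennreal (exp ((2 * r - s) * l) * (D l \<omega>)\<^sup>2) * indicator {0..t} l" for l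
    proof -
      have "exp ((2 * r - s) * l) = exp ((r - s / 2) * l) * exp ((r - s / 2) * l)"
        by (simp add: exp_add[symmetric] algebra_simps)
      then show ?thesis
        by (auto simp: g_def power2_eq_square ennreal_mult'[symmetric] split: split_indicator)
    qed
    show ?thesis
      using Cauchy_Schwarz_nn_integral[of f lborel g] by (simp add: fg f2 g2 A_def B_def)
  qed
  have "(\<integral>\<^sup>+\<omega>. (\<integral>\<^sup>+l. ennreal (exp (r * l) * \<bar>D l \<omega>\<bar>) * indicator {0..t} l \<partial>lborel)\<^sup>2 \<partial>M) \<le> (\<integral>\<^sup>+\<omega>. A * B \<omega> \<partial>M)"
    by (intro nn_integral_mono pw)
  also have "\<dots> = A * (\<integral>\<^sup>+\<omega>. B \<omega> \<partial>M)"
    unfolding B_def by (intro nn_integral_cmult) measurable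
  also have "(\<integral>\<^sup>+\<omega>. B \<omega> \<partial>M) = (\<integral>\<^sup>+l. (\<integral>\<^sup>+\<omega>. ennreal (exp ((2 * r - s) * l) * (D l \<omega>)\<^sup>2) * indicator {0..t} l \<partial>M) \<partial>lborel)"
    unfolding B_def by (rule LM.Fubini') measurable
  also have "\<dots> \<le> (\<integral>\<^sup>+l. ennreal (K\<^sup>2) * (ennreal (exp (s * l)) * indicator {0..t} l) \<partial>lborel)"
  proof (intro nn_integral_mono)
    fix l
    show "(\<integral>\<^sup>+\<omega>. ennreal (exp ((2 * r - s) * l) * (D l \<omega>)\<^sup>2) * indicator {0..t} l \<partial>M)
      \<le> ennreal (K\<^sup>2) * (ennreal (exp (s * l)) * indicator {0..t} l)"
    proof (cases "0 < l \<and> l \<le> t")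
      case True
      have "(\<integral>\<^sup>+\<omega>. ennreal (exp ((2 * r - s) * l) * (D l \<omega>)\<^sup>2) * indicator {0..t} l \<partial>M)
        = ennreal (exp ((2 * r - s) * l)) * (\<integral>\<^sup>+\<omega>. ennreal ((D l \<omega>)\<^sup>2) \<partial>M)"
        using True by (simp add: ennreal_mult' nn_integral_cmult)
      also have "\<dots> \<le> ennreal (exp ((2 * r - s) * l)) * ennreal (K\<^sup>2 * exp (- \<beta> * l))"
        using True by (intro mult_left_mono D_L2) auto
      also have "\<dots> = ennreal (K\<^sup>2) * ennreal (exp ((2 * r - s - \<beta>) * l))"
      proof -
        have "exp ((2 * r - s - \<beta>) * l) = exp ((2 * r - s) * l) * exp (- \<beta> * l)"
          by (simp add: exp_add[symmetric] algebra_simps)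
        then have "exp ((2 * r - s) * l) * (K\<^sup>2 * exp (- \<beta> * l)) = K\<^sup>2 * exp ((2 * r - s - \<beta>) * l)"
          by simp
        then show ?thesis by (simp add: ennreal_mult'[symmetric])
      qed
      also have "\<dots> \<le> ennreal (K\<^sup>2) * ennreal (exp (s * l))"
        using True s by (intro mult_left_mono ennreal_leI) (auto intro!: mult_right_mono)
      finally show ?thesis using True by simp
    next
      case False
      then show ?thesis by (cases "l \<in> {0..t}") auto
    qed
  qed
  also have "\<dots> = ennreal (K\<^sup>2) * A"
    unfolding A_def by (intro nn_integral_cmult) measurable
  finally have "(\<integral>\<^sup>+\<omega>. (\<integral>\<^sup>+l. ennreal (exp (r * l) * \<bar>D l \<omega>\<bar>) * indicator {0..t} l \<partial>lborel)\<^sup>2 \<partial>M)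
      \<le> A * (ennreal (K\<^sup>2) * A)"
    by (simp add: mult_left_mono)
  also have "\<dots> \<le> ennreal (exp (s * t) / s) * (ennreal (K\<^sup>2) * ennreal (exp (s * t) / s))"
    by (intro mult_mono A_le) auto
  also have "\<dots> = ennreal ((K * exp (s * t) / s)\<^sup>2)"
    using s by (simp add: ennreal_mult'[symmetric] power2_eq_square field_simps)
  finally show ?thesis .
qed

text \<open>Young's inequality |x| \<le> q / 2 + x^2 / (2 q), with q the square root of the decay
  factor exp (- \<beta> l), balances both terms: the first absolute moment is a multiple of q, which
  is integrable in l.\<close>

lemma integrable_D: "integrable (lborel \<Otimes>\<^sub>M M) (\<lambda>(l, \<omega>). D l \<omega>)"
proof (rule integrableI_bounded)
  have bound: "(\<integral>\<^sup>+\<omega>. ennreal \<bar>D l \<omega>\<bar> \<partial>M) \<le> ennreal ((1 + K\<^sup>2) / 2 * exp (- (\<beta> / 2) * l)) * indicator {0..} l" for l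
  proof (cases "l > 0")
    case True
    define q where "q = exp (- (\<beta> / 2) * l)"
    have q: "q > 0" "exp (- \<beta> * l) = q * q"
      by (auto simp: q_def exp_add[symmetric])
    have "\<bar>x\<bar> \<le> q / 2 + x\<^sup>2 / (2 * q)" for x :: real
    proof -
      have "0 \<le> (q - \<bar>x\<bar>)\<^sup>2" by simp
      then have "2 * q * \<bar>x\<bar> \<le> q * q + x\<^sup>2" by (simp add: power2_eq_square algebra_simps)
      then show ?thesis using q(1) by (simp add: field_simps power2_eq_square)
    qed
    then have "(\<integral>\<^sup>+\<omega>. ennreal \<bar>D l \<omega>\<bar> \<partial>M) \<le> (\<integral>\<^sup>+\<omega>. ennreal (q / 2) + ennreal (1 / (2 * q)) * ennreal ((D l \<omega>)\<^sup>2) \<partial>M)"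
      using q by (intro nn_integral_mono) (simp add: ennreal_mult'[symmetric] ennreal_plus[symmetric] del: ennreal_plus)
    also have "\<dots> = ennreal (q / 2) + ennreal (1 / (2 * q)) * (\<integral>\<^sup>+\<omega>. ennreal ((D l \<omega>)\<^sup>2) \<partial>M)"
      by (simp add: nn_integral_add nn_integral_cmult emeasure_space_1)
    also have "\<dots> \<le> ennreal (q / 2) + ennreal (1 / (2 * q)) * ennreal (K\<^sup>2 * (q * q))"
      using D_L2[OF True] unfolding q(2) by (intro add_left_mono mult_left_mono) auto
    also have "\<dots> = ennreal ((1 + K\<^sup>2) / 2 * q)"
      using q by (simp add: ennreal_mult'[symmetric] ennreal_plus[symmetric] field_simps del: ennreal_plus)
    finally show ?thesis using True by (simp add: q_def)
  qed simp
  have "(\<integral>\<^sup>+p. ennreal (norm (case p of (l, \<omega>) \<Rightarrow> D l \<omega>)) \<partial>(lborel \<Otimes>\<^sub>M M)) =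
      (\<integral>\<^sup>+l. (\<integral>\<^sup>+\<omega>. ennreal \<bar>D l \<omega>\<bar> \<partial>M) \<partial>lborel)"
    by (subst nn_integral_fst[symmetric]) auto
  also have "\<dots> \<le> (\<integral>\<^sup>+l. ennreal ((1 + K\<^sup>2) / 2 * exp (- (\<beta> / 2) * l)) * indicator {0..} l \<partial>lborel)"
    by (intro nn_integral_mono bound)
  also have "\<dots> = 0 - (- ((1 + K\<^sup>2) / \<beta>) * exp (- (\<beta> / 2) * 0))"
  proof (rule nn_integral_FTC_atLeast)
    have "((\<lambda>l. - ((1 + K\<^sup>2) / \<beta>) * exp (- (\<beta> / 2) * l)) \<longlongrightarrow> - ((1 + K\<^sup>2) / \<beta>) * 0) at_top"
      using \<beta> by (intro tendsto_intros filterlim_compose[OF exp_at_bot] filterlim_tendsto_neg_mult_at_bot[OF tendsto_const] filterlim_ident) auto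
    then show "((\<lambda>l. - ((1 + K\<^sup>2) / \<beta>) * exp (- (\<beta> / 2) * l)) \<longlongrightarrow> 0) at_top" by simp
  qed (use \<beta> in \<open>auto intro!: derivative_eq_intros simp: field_simps\<close>)
  also have "\<dots> < \<infinity>" by simp
  finally show "(\<integral>\<^sup>+p. ennreal (norm (case p of (l, \<omega>) \<Rightarrow> D l \<omega>)) \<partial>(lborel \<Otimes>\<^sub>M M)) < \<infinity>" .
qed measurable

lemma integrable_weighted_D:
  assumes [measurable]: "w \<in> borel_measurable lborel" and w: "\<And>l. l > 0 \<Longrightarrow> \<bar>w l\<bar> \<le> B"
  shows "integrable (lborel \<Otimes>\<^sub>M M) (\<lambda>(l, \<omega>). w l * D l \<omega>)"
proof (rule Bochner_Integration.integrable_bound)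
  show "integrable (lborel \<Otimes>\<^sub>M M) (\<lambda>p. B * (case p of (l, \<omega>) \<Rightarrow> D l \<omega>))"
    using integrable_D by (rule integrable_mult_right)
  have "\<bar>w l\<bar> * \<bar>D l \<omega>\<bar> \<le> \<bar>B\<bar> * \<bar>D l \<omega>\<bar>" for l \<omega>
    using order_trans[OF w abs_ge_self, of l] by (cases "l > 0") (auto intro!: mult_right_mono)
  then show "AE p in lborel \<Otimes>\<^sub>M M. norm (case p of (l, \<omega>) \<Rightarrow> w l * D l \<omega>) \<le> norm (B * (case p of (l, \<omega>) \<Rightarrow> D l \<omega>))"
    by (intro AE_I2) (auto simp: abs_mult split: prod.split)
qed measurable

lemma AE_integrable_D: "AE \<omega> in M. integrable lborel (\<lambda>l. D l \<omega>)"
  using LM.AE_integrable_snd[OF integrable_D] .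

lemma expectation_integral_weighted_D:
  assumes "w \<in> borel_measurable lborel" "\<And>l. l > 0 \<Longrightarrow> \<bar>w l\<bar> \<le> B"
  shows "integrable M (\<lambda>\<omega>. LBINT l. w l * D l \<omega>)"
    and "integrable lborel (\<lambda>l. w l * expectation (D l))"
    and "expectation (\<lambda>\<omega>. LBINT l. w l * D l \<omega>) = (LBINT l. w l * expectation (D l))"
  using LM.integrable_snd[OF integrable_weighted_D[OF assms]] LM.integrable_fst[OF integrable_weighted_D[OF assms]]
    LM.Fubini_integral[OF integrable_weighted_D[OF assms]]
  by simp_all

end

section \<open>Moments of one sample\<close>

text \<open>If f is not integrable its integral is 0 by convention, so the bound holds for every
  path, without an exceptional null set.\<close>

lemma square_LBINT_le:
  fixes f g :: "real \<Rightarrow> real"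
  assumes "\<And>l. \<bar>f l\<bar> \<le> g l"
  shows "ennreal ((LBINT l. f l)\<^sup>2) \<le> (\<integral>\<^sup>+l. ennreal (g l) \<partial>lborel)\<^sup>2"
proof (cases "integrable lborel f")
  case True
  have "ennreal \<bar>LBINT l. f l\<bar> \<le> (\<integral>\<^sup>+l. ennreal \<bar>f l\<bar> \<partial>lborel)"
    using integral_norm_bound_ennreal[OF True] by simp
  also have "\<dots> \<le> (\<integral>\<^sup>+l. ennreal (g l) \<partial>lborel)"
    using assms by (intro nn_integral_mono ennreal_leI)
  finally have "(ennreal \<bar>LBINT l. f l\<bar>)\<^sup>2 \<le> (\<integral>\<^sup>+l. ennreal (g l) \<partial>lborel)\<^sup>2"
    by (rule power_mono) simp
  then show ?thesis by (simp add: ennreal_power)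
qed (simp add: not_integrable_integral_eq)

text \<open>\<open>Q\<close> and \<open>D\<close> are tied together only by \<open>D_FTC\<close>,
  the increment form of the weak derivative, with one null set for all a and b.\<close>

locale clmc_process = decaying_process M D K \<beta>
  for M :: "'a measure" and D :: "real \<Rightarrow> 'a \<Rightarrow> real" and K \<beta> :: real +
  fixes Q :: "real \<Rightarrow> 'a \<Rightarrow> real" and L :: "'a \<Rightarrow> real" and r :: real
  assumes r: "0 < r"
    and L_exp: "distributed M lborel L (exponential_density r)"
    and L_indep: "indep_rvs M (\<Pi>\<^sub>M l\<in>{0..}. borel) (\<lambda>\<omega>. \<lambda>l\<in>{0..}. Q l \<omega>) borel L"
    and D_FTC: "AE \<omega> in M. \<forall>a b. 0 \<le> a \<longrightarrow> a \<le> b \<longrightarrow> Q b \<omega> - Q a \<omega> = (LBINT l:{a<..b}. D l \<omega>)"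
begin

section \<open>One sample as the weighted integral F stopped at a random level\<close>

definition weighted_integral :: "real \<Rightarrow> 'a \<Rightarrow> real" where
  "weighted_integral t \<omega> = (LBINT l:{0<..t}. exp (r * l) * D l \<omega>)"

text \<open>\<open>L\<close> is nonnegative only almost surely; the clamp at 0 puts the level in
  {0..b} everywhere, as freezing requires.\<close>

definition truncated_level :: "real \<Rightarrow> 'a \<Rightarrow> real" where
  "truncated_level b \<omega> = max 0 (min (L \<omega>) b)"

text \<open>\<open>clmc_summand\<close> with the survival probability evaluated and the level 0
  removed.\<close>

definition sample :: "real \<Rightarrow> 'a \<Rightarrow> real" where
  "sample b \<omega> = (LBINT l:{0<..b}. exp (r * l) * D l \<omega> * indicator {0..L \<omega>} l)"

lemma L_meas [measurable]: "L \<in> borel_measurable M"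
  using distributed_measurable[OF L_exp] by simp

lemma L_nonneg: "AE \<omega> in M. 0 \<le> L \<omega>"
  using exponential_distributed_nonneg[OF L_exp r] .

lemma truncated_level_meas [measurable]: "truncated_level b \<in> borel_measurable M"
  unfolding truncated_level_def[abs_def] by measurable

lemma truncated_level_range: "0 \<le> b \<Longrightarrow> truncated_level b \<omega> \<in> {0..b}"
  by (auto simp: truncated_level_def)

lemma weighted_integral_meas [measurable]: "weighted_integral t \<in> borel_measurable M"
  unfolding weighted_integral_def[abs_def] set_lebesgue_integral_def by measurable

lemma sample_meas [measurable]: "sample b \<in> borel_measurable M"
proof -
  have "(\<lambda>\<omega>. LBINT l. indicator {0<..b} l *\<^sub>R (exp (r * l) * D l \<omega> * (if 0 \<le> l \<and> l \<le> L \<omega> then 1 else 0))) \<in> borel_measurable M"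
    by measurable
  also have "(\<lambda>\<omega>. LBINT l. indicator {0<..b} l *\<^sub>R (exp (r * l) * D l \<omega> * (if 0 \<le> l \<and> l \<le> L \<omega> then 1 else 0))) = sample b"
    by (auto simp: sample_def set_lebesgue_integral_def fun_eq_iff intro!: Bochner_Integration.integral_cong split: split_indicator)
  finally show ?thesis .
qed

lemma sample_eq_weighted_integral:
  assumes "0 \<le> b"
  shows "AE \<omega> in M. sample b \<omega> = weighted_integral (truncated_level b \<omega>) \<omega>"
  using L_nonneg
proof eventually_elim
  case (elim \<omega>)
  then show ?case using assms
    unfolding sample_def weighted_integral_def set_lebesgue_integral_def
    by (intro Bochner_Integration.integral_cong) (auto simp: truncated_level_def split: split_indicator)
qed

text \<open>
  The weighted integral of the weak derivative is an almost sure limit of Riemann-Stieltjes sums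
  in the increments of \<open>Q\<close>; this transfers the independence of \<open>L\<close> from \<open>Q\<close> to the derivative,
  whose value at a fixed level need not be measurable with respect to \<open>Q\<close>.
\<close>

lemma weighted_integral_indep:
  assumes t: "0 \<le> t"
  shows "\<exists>Z. indep_var borel Z borel (truncated_level b) \<and> (AE \<omega> in M. weighted_integral t \<omega> = Z \<omega>)"
proof -
  let ?V = "vimage_algebra (space M) (\<lambda>\<omega>. \<lambda>l\<in>{0..}. Q l \<omega>) (\<Pi>\<^sub>M l\<in>{0..}. borel)"
  define h where "h n = t / real (Suc n)" for n
  define S where "S n \<omega> = (\<Sum>i<Suc n. exp (r * (real i * h n)) * (Q (real (Suc i) * h n) \<omega> - Q (real i * h n) \<omega>))" for n \<omega>
  have h: "0 \<le> h n" for n using t by (simp add: h_def)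
  have "(\<lambda>\<omega>. \<lambda>l\<in>{0..}. Q l \<omega>) \<in> measurable M (\<Pi>\<^sub>M l\<in>{0..}. borel)"
    using L_indep by (simp add: indep_rvs_def)
  then have "(\<lambda>\<omega>. \<lambda>l\<in>{0..}. Q l \<omega>) \<in> space M \<rightarrow> space (\<Pi>\<^sub>M l\<in>{0..}. borel)"
    by (auto dest: measurable_space)
  then have V: "(\<lambda>\<omega>. \<lambda>l\<in>{0..}. Q l \<omega>) \<in> measurable ?V (\<Pi>\<^sub>M l\<in>{0..}. borel)"
    by (rule measurable_vimage_algebra1)
  have Q_V: "Q l \<in> borel_measurable ?V" if "0 \<le> l" for l
    using measurable_compose[OF V measurable_component_singleton[of l "{0..}"]] that by simp
  have S_V: "S n \<in> borel_measurable ?V" for n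
    unfolding S_def[abs_def] using h
    by (intro borel_measurable_sum borel_measurable_times borel_measurable_diff borel_measurable_const Q_V) auto
  \<comment> \<open>\<open>lim\<close> is measurable for the sigma-algebra of \<open>Q\<close> even
    where the sums diverge, so it serves as an everywhere defined modification.\<close>
  then have "(\<lambda>\<omega>. lim (\<lambda>n. S n \<omega>)) \<in> borel_measurable ?V"
    by (rule borel_measurable_lim_metric)
  moreover have "(\<lambda>x. max 0 (min x b)) \<in> borel_measurable borel"
    by measurable
  ultimately have "indep_var borel (\<lambda>\<omega>. lim (\<lambda>n. S n \<omega>)) borel (truncated_level b)"
    unfolding truncated_level_def[abs_def] by (rule indep_rvs_compose[OF L_indep])
  moreover have "AE \<omega> in M. weighted_integral t \<omega> = lim (\<lambda>n. S n \<omega>)"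
    using AE_integrable_D D_FTC
  proof eventually_elim
    case (elim \<omega>)
    have "Q (real (Suc i) * h n) \<omega> - Q (real i * h n) \<omega> = (LBINT l:{real i * h n<..real (Suc i) * h n}. D l \<omega>)" for i n
      by (rule elim(2)[rule_format]) (use h[of n] in \<open>auto intro!: mult_right_mono\<close>)
    then have "(\<lambda>n. S n \<omega>) \<longlonglongrightarrow> weighted_integral t \<omega>"
      using riemann_stieltjes_exp_tendsto[OF elim(1) less_imp_le[OF r] t]
      by (simp only: S_def weighted_integral_def h_def)
    then show ?case by (simp add: limI)
  qed
  ultimately show ?thesis by blast
qed

lemma weighted_integral_continuous: "AE \<omega> in M. continuous_on {0..b} (\<lambda>t. weighted_integral t \<omega>)"
  using AE_integrable_D
proof eventually_elim
  case (elim \<omega>)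
  have int: "set_integrable lborel {0..t} (\<lambda>l. exp (r * l) * D l \<omega>)" for t
    unfolding set_integrable_def
  proof (rule Bochner_Integration.integrable_bound)
    show "integrable lborel (\<lambda>l. exp (r * t) * D l \<omega>)"
      using elim by simp
    show "(\<lambda>l. indicat_real {0..t} l *\<^sub>R (exp (r * l) * D l \<omega>)) \<in> borel_measurable lborel"
      using elim by measurable
    show "AE l in lborel. norm (indicat_real {0..t} l *\<^sub>R (exp (r * l) * D l \<omega>)) \<le> norm (exp (r * t) * D l \<omega>)"
      using r by (intro AE_I2) (auto simp: abs_mult intro!: mult_right_mono split: split_indicator)
  qed
  have "weighted_integral t \<omega> = integral {0..t} (\<lambda>l. exp (r * l) * D l \<omega>)" for t
  proof -
    have "weighted_integral t \<omega> = (LBINT l:{0..t}. exp (r * l) * D l \<omega>)"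
      unfolding weighted_integral_def set_lebesgue_integral_def
      by (intro Bochner_Integration.integral_cong) (auto split: split_indicator)
    then show ?thesis using set_borel_integral_eq_integral(2)[OF int] by simp
  qed
  then show ?case
    using indefinite_integral_continuous_1[OF set_borel_integral_eq_integral(1)[OF int[of b]]] by simp
qed

section \<open>A dominating variable for freezing, and second moments\<close>

definition dominating_integral :: "real \<Rightarrow> 'a \<Rightarrow> real" where
  "dominating_integral b \<omega> = (LBINT l:{0<..b}. exp (r * l) * \<bar>D l \<omega>\<bar>)"

lemma dominating_integral_meas [measurable]: "dominating_integral b \<in> borel_measurable M"
  unfolding dominating_integral_def[abs_def] set_lebesgue_integral_def by measurable

lemma weighted_integral_dominated:
  "AE \<omega> in M. \<forall>t\<in>{0..b}. \<bar>weighted_integral t \<omega>\<bar> \<le> dominating_integral b \<omega>"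
  using AE_integrable_D
proof eventually_elim
  case (elim \<omega>)
  have int: "integrable lborel (\<lambda>l. indicator {0<..b} l *\<^sub>R (exp (r * l) * \<bar>D l \<omega>\<bar>))"
  proof (rule Bochner_Integration.integrable_bound)
    show "integrable lborel (\<lambda>l. exp (r * b) * D l \<omega>)"
      using elim by simp
    show "(\<lambda>l. indicat_real {0<..b} l *\<^sub>R (exp (r * l) * \<bar>D l \<omega>\<bar>)) \<in> borel_measurable lborel"
      using elim by measurable
    show "AE l in lborel. norm (indicat_real {0<..b} l *\<^sub>R (exp (r * l) * \<bar>D l \<omega>\<bar>)) \<le> norm (exp (r * b) * D l \<omega>)"
      using r by (intro AE_I2) (auto simp: abs_mult intro!: mult_right_mono split: split_indicator)
  qed
  show ?case
  proof
    fix t assume "t \<in> {0..b}"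
    have "\<bar>weighted_integral t \<omega>\<bar> \<le> (LBINT l. \<bar>indicator {0<..t} l *\<^sub>R (exp (r * l) * D l \<omega>)\<bar>)"
      unfolding weighted_integral_def set_lebesgue_integral_def by (rule integral_abs_bound)
    also have "\<dots> \<le> dominating_integral b \<omega>"
      unfolding dominating_integral_def set_lebesgue_integral_def
      using \<open>t \<in> {0..b}\<close> by (intro integral_mono'[OF int]) (auto simp: abs_mult split: split_indicator)
    finally show "\<bar>weighted_integral t \<omega>\<bar> \<le> dominating_integral b \<omega>" .
  qed
qed

lemma nn_integral_square_le:
  assumes s: "0 < s" "2 * r - \<beta> \<le> 2 * s" and t: "0 \<le> t"
    and f: "\<And>\<omega> l. \<bar>f \<omega> l\<bar> \<le> exp (r * l) * \<bar>D l \<omega>\<bar> * indicator {0..t} l"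
  shows "(\<integral>\<^sup>+\<omega>. ennreal ((LBINT l. f \<omega> l)\<^sup>2) \<partial>M) \<le> ennreal ((K * exp (s * t) / s)\<^sup>2)"
proof -
  have "(\<integral>\<^sup>+\<omega>. ennreal ((LBINT l. f \<omega> l)\<^sup>2) \<partial>M)
      \<le> (\<integral>\<^sup>+\<omega>. (\<integral>\<^sup>+l. ennreal (exp (r * l) * \<bar>D l \<omega>\<bar>) * indicator {0..t} l \<partial>lborel)\<^sup>2 \<partial>M)"
  proof (rule nn_integral_mono)
    fix \<omega>
    have "ennreal ((LBINT l. f \<omega> l)\<^sup>2) \<le> (\<integral>\<^sup>+l. ennreal (exp (r * l) * \<bar>D l \<omega>\<bar> * indicator {0..t} l) \<partial>lborel)\<^sup>2"
      by (rule square_LBINT_le[OF f])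
    also have "(\<integral>\<^sup>+l. ennreal (exp (r * l) * \<bar>D l \<omega>\<bar> * indicator {0..t} l) \<partial>lborel)
        = (\<integral>\<^sup>+l. ennreal (exp (r * l) * \<bar>D l \<omega>\<bar>) * indicator {0..t} l \<partial>lborel)"
      by (intro nn_integral_cong) (auto split: split_indicator)
    finally show "ennreal ((LBINT l. f \<omega> l)\<^sup>2)
        \<le> (\<integral>\<^sup>+l. ennreal (exp (r * l) * \<bar>D l \<omega>\<bar>) * indicator {0..t} l \<partial>lborel)\<^sup>2" .
  qed
  also note nn_integral_weighted_square[OF s t]
  finally show ?thesis .
qed

lemma dominating_integral_integrable:
  assumes "0 \<le> b"
  shows "integrable M (\<lambda>\<omega>. (dominating_integral b \<omega>)\<^sup>2)" "integrable M (dominating_integral b)"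
proof -
  \<comment> \<open>Only finiteness matters here, so the choice s = r is good enough: its condition
    2 r - \<beta> \<le> 2 r holds because \<beta> is positive.\<close>
  have "(\<integral>\<^sup>+\<omega>. ennreal ((dominating_integral b \<omega>)\<^sup>2) \<partial>M) \<le> ennreal ((K * exp (r * b) / r)\<^sup>2)"
    unfolding dominating_integral_def set_lebesgue_integral_def
    using r \<beta> assms by (intro nn_integral_square_le) (auto simp: abs_mult split: split_indicator)
  then show sq: "integrable M (\<lambda>\<omega>. (dominating_integral b \<omega>)\<^sup>2)"
    by (intro integrableI_bounded) (auto intro: le_less_trans)
  show "integrable M (dominating_integral b)"
    by (rule square_integrable_imp_integrable[OF _ sq]) measurable
qed

lemma expectation_weighted_integral_square:
  assumes s: "0 < s" "2 * r - \<beta> \<le> 2 * s" and t: "0 \<le> t"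
  shows "expectation (\<lambda>\<omega>. (weighted_integral t \<omega>)\<^sup>2) \<le> (K / s)\<^sup>2 * exp (2 * s * t)"
proof -
  have "(\<integral>\<^sup>+\<omega>. ennreal ((weighted_integral t \<omega>)\<^sup>2) \<partial>M) \<le> ennreal ((K * exp (s * t) / s)\<^sup>2)"
    unfolding weighted_integral_def set_lebesgue_integral_def
    using assms by (intro nn_integral_square_le) (auto simp: abs_mult split: split_indicator)
  then have "expectation (\<lambda>\<omega>. (weighted_integral t \<omega>)\<^sup>2) \<le> (K * exp (s * t) / s)\<^sup>2"
    by (intro integral_real_bounded) auto
  also have "\<dots> = (K / s)\<^sup>2 * exp (2 * s * t)"
    by (simp add: power_divide power_mult_distrib power2_eq_square exp_add[symmetric])
  finally show ?thesis .
qed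

lemma LBINT_indicator_level:
  fixes h :: "real \<Rightarrow> real"
  assumes "0 \<le> L \<omega>" "0 \<le> b"
  shows "(LBINT l:{0..b}. h l * indicator {0..L \<omega>} l) = (LBINT l:{0..truncated_level b \<omega>}. h l)"
  unfolding set_lebesgue_integral_def using assms
  by (intro Bochner_Integration.integral_cong) (auto simp: truncated_level_def split: split_indicator)

text \<open>Freezing the level reduces the claim to the expectation of exp (2 s T). Writing exp (2 s
  T) as 1 plus the integral of its derivative up to T brings in the survival probability, whence the
  exponent 2 s - r.\<close>

lemma sample_second_moment:
  assumes b: "0 \<le> b" and s: "0 < s" "2 * r - \<beta> \<le> 2 * s"
  shows "integrable M (\<lambda>\<omega>. (sample b \<omega>)\<^sup>2)"
    and "expectation (\<lambda>\<omega>. (sample b \<omega>)\<^sup>2) \<le> (K / s)\<^sup>2 * (1 + 2 * s * (LBINT l:{0..b}. exp ((2 * s - r) * l)))"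
proof -
  let ?Z = "\<lambda>t \<omega>. (weighted_integral t \<omega>)\<^sup>2"
  let ?T = "truncated_level b"
  have indep: "\<exists>Z'. indep_var borel Z' borel ?T \<and> (AE \<omega> in M. ?Z t \<omega> = Z' \<omega>)" if t: "t \<in> {0..b}" for t
  proof -
    obtain Z where Z: "indep_var borel Z borel ?T" "AE \<omega> in M. weighted_integral t \<omega> = Z \<omega>"
      using weighted_integral_indep[of t b] t by auto
    have "indep_var borel ((\<lambda>x. x\<^sup>2) \<circ> Z) borel (id \<circ> ?T)"
      using Z(1) by (rule indep_var_compose) measurable
    then have "indep_var borel (\<lambda>\<omega>. (Z \<omega>)\<^sup>2) borel ?T" by (simp add: comp_def)
    moreover have "AE \<omega> in M. ?Z t \<omega> = (Z \<omega>)\<^sup>2" using Z(2) by eventually_elim simp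
    ultimately show ?thesis by blast
  qed
  have cont: "AE \<omega> in M. continuous_on {0..b} (\<lambda>t. ?Z t \<omega>)"
    using weighted_integral_continuous[of b] by eventually_elim (rule continuous_on_power)
  have dom: "AE \<omega> in M. \<forall>t\<in>{0..b}. \<bar>?Z t \<omega>\<bar> \<le> (dominating_integral b \<omega>)\<^sup>2"
    using weighted_integral_dominated[of b]
  proof eventually_elim
    case (elim \<omega>)
    then show ?case by (metis abs_ge_zero abs_power2 power2_abs power_mono)
  qed
  have eq: "AE \<omega> in M. (sample b \<omega>)\<^sup>2 = ?Z (?T \<omega>) \<omega>"
    using sample_eq_weighted_integral[OF b] by eventually_elim simp
  note frozen = indep_var_frozen_expectation[where Z="?Z" and T="?T" and b=b, OF truncated_level_meas
      truncated_level_range[OF b] _ indep cont dominating_integral_integrable(1)[OF b] dom _ eq]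
  show "integrable M (\<lambda>\<omega>. (sample b \<omega>)\<^sup>2)"
    by (rule frozen(1)) measurable
  let ?h = "\<lambda>l. 2 * s * exp (2 * s * l)"
  have h: "set_integrable lborel {0..b} ?h"
    by (intro borel_integrable_atLeastAtMost' continuous_intros)
  note trunc = exponential_distributed_truncated_integral[OF L_exp r h]
  have exp_eq: "AE \<omega> in M. exp (2 * s * ?T \<omega>) = 1 + (LBINT l:{0..b}. ?h l * indicator {0..L \<omega>} l)"
    using L_nonneg
  proof eventually_elim
    case (elim \<omega>)
    have "(LBINT l:{0..?T \<omega>}. ?h l) = 2 * s * ((exp (2 * s * ?T \<omega>) - 1) / (2 * s))"
      using s truncated_level_range[OF b, of \<omega>] LBINT_exp_Icc[of "2 * s" "?T \<omega>"]
      by (simp add: set_integral_mult_right)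
    then show ?case using s LBINT_indicator_level[OF elim b] by simp
  qed
  have int: "integrable M (\<lambda>\<omega>. (K / s)\<^sup>2 * (1 + (LBINT l:{0..b}. ?h l * indicator {0..L \<omega>} l)))"
    using trunc(1) by simp
  have "expectation (\<lambda>\<omega>. (sample b \<omega>)\<^sup>2) = expectation (\<lambda>\<omega>. expectation (?Z (?T \<omega>)))"
    by (rule frozen(3)) measurable
  also have "\<dots> \<le> expectation (\<lambda>\<omega>. (K / s)\<^sup>2 * (1 + (LBINT l:{0..b}. ?h l * indicator {0..L \<omega>} l)))"
  proof (rule integral_mono_AE[OF frozen(2) int])
    show "AE \<omega> in M. expectation (?Z (?T \<omega>)) \<le> (K / s)\<^sup>2 * (1 + (LBINT l:{0..b}. ?h l * indicator {0..L \<omega>} l))"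
      using exp_eq
    proof eventually_elim
      case (elim \<omega>)
      have "expectation (?Z (?T \<omega>)) \<le> (K / s)\<^sup>2 * exp (2 * s * ?T \<omega>)"
        using truncated_level_range[OF b, of \<omega>] by (intro expectation_weighted_integral_square s) auto
      then show ?case unfolding elim .
    qed
  qed measurable
  also have "\<dots> = (K / s)\<^sup>2 * (1 + (LBINT l:{0..b}. ?h l * exp (- r * l)))"
    using trunc by (simp add: prob_space)
  also have "(LBINT l:{0..b}. ?h l * exp (- r * l)) = 2 * s * (LBINT l:{0..b}. exp ((2 * s - r) * l))"
    by (subst set_integral_mult_right[symmetric])
       (auto simp: mult.assoc exp_add[symmetric] algebra_simps intro!: arg_cong[where f="integral\<^sup>L lborel"] simp: set_lebesgue_integral_def)
  finally show "expectation (\<lambda>\<omega>. (sample b \<omega>)\<^sup>2)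
      \<le> (K / s)\<^sup>2 * (1 + 2 * s * (LBINT l:{0..b}. exp ((2 * s - r) * l)))" .
qed

text \<open>The weight exp (r l) is the reciprocal of the survival probability and cancels against
  it. The level is frozen first, so that independence is used only for the integrated process and
  never for \<open>D l\<close> at one level.\<close>

lemma expectation_sample:
  assumes b: "0 \<le> b"
  shows "integrable M (sample b)" "expectation (sample b) = (LBINT l:{0<..b}. expectation (D l))"
proof -
  let ?T = "truncated_level b"
  let ?h = "\<lambda>l. exp (r * l) * expectation (D l)"
  have w: "(\<lambda>l. indicator {0<..t} l * exp (r * l)) \<in> borel_measurable lborel"
    "\<And>l. l > 0 \<Longrightarrow> \<bar>indicator {0<..t} l * exp (r * l)\<bar> \<le> exp (r * t)" for t
    using r by (auto split: split_indicator)
  note E = expectation_integral_weighted_D[OF w]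
  have E_weighted: "expectation (weighted_integral t) = (LBINT l:{0..t}. ?h l)" for t
  proof -
    have "expectation (weighted_integral t) = (LBINT l. indicator {0<..t} l * exp (r * l) * expectation (D l))"
      using E(3)[of t] unfolding weighted_integral_def[abs_def] set_lebesgue_integral_def by (simp add: mult.assoc)
    also have "\<dots> = (LBINT l:{0..t}. ?h l)"
      unfolding set_lebesgue_integral_def
      by (intro Bochner_Integration.integral_cong) (auto simp: expectation_D_nonpos split: split_indicator)
    finally show ?thesis .
  qed
  have h: "set_integrable lborel {0..b} ?h"
  proof -
    have "integrable lborel (\<lambda>l. indicator {0<..b} l * exp (r * l) * expectation (D l))"
      by (rule E(2))
    also have "(\<lambda>l. indicator {0<..b} l * exp (r * l) * expectation (D l)) = (\<lambda>l. indicator {0..b} l *\<^sub>R ?h l)"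
      by (auto simp: fun_eq_iff expectation_D_nonpos split: split_indicator)
    finally show ?thesis unfolding set_integrable_def .
  qed
  note trunc = exponential_distributed_truncated_integral[OF L_exp r h]
  note frozen = indep_var_frozen_expectation[where Z=weighted_integral and T="?T" and b=b, OF truncated_level_meas
      truncated_level_range[OF b] _ _ weighted_integral_continuous dominating_integral_integrable(2)[OF b]
      weighted_integral_dominated sample_meas sample_eq_weighted_integral[OF b]]
  have indep: "\<exists>Z. indep_var borel Z borel ?T \<and> (AE \<omega> in M. weighted_integral t \<omega> = Z \<omega>)" if "t \<in> {0..b}" for t
    using weighted_integral_indep[of t b] that by simp
  show "integrable M (sample b)"
    by (rule frozen(1)) (use indep in auto)
  have "expectation (sample b) = expectation (\<lambda>\<omega>. expectation (weighted_integral (?T \<omega>)))"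
    by (rule frozen(3)) (use indep in auto)
  also have "\<dots> = expectation (\<lambda>\<omega>. LBINT l:{0..b}. ?h l * indicator {0..L \<omega>} l)"
  proof (rule integral_cong_AE)
    show "(\<lambda>\<omega>. expectation (weighted_integral (?T \<omega>))) \<in> borel_measurable M"
      using frozen(2) indep by (auto intro: borel_measurable_integrable)
    show "(\<lambda>\<omega>. LBINT l:{0..b}. ?h l * indicator {0..L \<omega>} l) \<in> borel_measurable M"
      using trunc(1) by (rule borel_measurable_integrable)
    show "AE \<omega> in M. expectation (weighted_integral (?T \<omega>)) = (LBINT l:{0..b}. ?h l * indicator {0..L \<omega>} l)"
      using L_nonneg by eventually_elim (simp only: E_weighted LBINT_indicator_level b)
  qed
  also have "\<dots> = (LBINT l:{0..b}. ?h l * exp (- r * l))"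
    by (rule trunc(2))
  also have "\<dots> = (LBINT l:{0<..b}. expectation (D l))"
    unfolding set_lebesgue_integral_def
    by (intro Bochner_Integration.integral_cong) (auto simp: expectation_D_nonpos exp_minus split: split_indicator)
  finally show "expectation (sample b) = (LBINT l:{0<..b}. expectation (D l))" .
qed

end

section \<open>Monte Carlo averages, cost and bias\<close>

text \<open>Centring at the true mean \<mu> instead of m makes the linear and the off-diagonal terms
  vanish; what remains is variance / N plus the squared bias, and the variance is at most the second
  moment. Integrability is recorded as well, because a non-integrable square would have expectation
  0 by convention.\<close>

lemma monte_carlo_mse:
  fixes Y :: "'a \<Rightarrow> real"
  assumes "prob_space M" and samples: "iid_samples M P X"
    and Y [measurable]: "Y \<in> borel_measurable M" and Y2: "integrable M (\<lambda>\<omega>. (Y \<omega>)\<^sup>2)" and N: "1 \<le> N"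
  defines "A \<equiv> \<lambda>\<xi>. 1 / real N * (\<Sum>k=1..N. Y (X k \<xi>))"
  shows "integrable P (\<lambda>\<xi>. (A \<xi> - m)\<^sup>2)"
    and "mean_squared_error P A m \<le> (\<integral>\<omega>. (Y \<omega>)\<^sup>2 \<partial>M) / real N + ((\<integral>\<omega>. Y \<omega> \<partial>M) - m)\<^sup>2"
proof -
  interpret M: prob_space M by fact
  interpret P: prob_space P using samples by (simp add: iid_samples_def)
  have indep: "P.indep_vars (\<lambda>_. M) X UNIV" and distr: "distr P M (X k) = M" for k
    using samples by (auto simp: iid_samples_def)
  have X [measurable]: "X k \<in> measurable P M" for k
    using indep by (simp add: P.indep_vars_def)
  have Y1: "integrable M Y"
    by (rule M.square_integrable_imp_integrable[OF Y Y2])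
  define \<mu> where "\<mu> = (\<integral>\<omega>. Y \<omega> \<partial>M)"
  define v where "v = (\<integral>\<omega>. (Y \<omega> - \<mu>)\<^sup>2 \<partial>M)"
  define U where "U k \<xi> = Y (X k \<xi>) - \<mu>" for k \<xi>
  have transfer: "has_bochner_integral P (\<lambda>\<xi>. f (X k \<xi>)) (\<integral>\<omega>. f \<omega> \<partial>M)" if "integrable M f" for f :: "'a \<Rightarrow> real" and k
  proof -
    have [measurable]: "f \<in> borel_measurable M" using that by auto
    show ?thesis
      using that integrable_distr_eq[OF X, of f k] integral_distr[OF X, of f k]
      by (simp add: distr has_bochner_integral_iff)
  qed
  have sq: "(Y \<omega> - \<mu>)\<^sup>2 = (Y \<omega>)\<^sup>2 - 2 * \<mu> * Y \<omega> + \<mu>\<^sup>2" for \<omega>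
    by (simp add: power2_eq_square algebra_simps)
  have v_int: "integrable M (\<lambda>\<omega>. (Y \<omega> - \<mu>)\<^sup>2)"
    unfolding sq using Y1 Y2 by simp
  have v_le: "v \<le> (\<integral>\<omega>. (Y \<omega>)\<^sup>2 \<partial>M)"
    unfolding v_def \<mu>_def using M.variance_eq[OF Y1 Y2] by simp
  have U1: "has_bochner_integral P (U k) 0" for k
  proof -
    have "(\<integral>\<omega>. Y \<omega> - \<mu> \<partial>M) = 0" using Y1 by (simp add: \<mu>_def M.prob_space)
    then show ?thesis
      using transfer[of "\<lambda>\<omega>. Y \<omega> - \<mu>" k] Y1 unfolding U_def[abs_def] by simp
  qed
  have indep_U: "P.indep_vars (\<lambda>_. borel) U UNIV"
    unfolding U_def[abs_def] by (rule P.indep_vars_compose2[OF indep]) measurable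
  have U2: "has_bochner_integral P (\<lambda>\<xi>. U j \<xi> * U k \<xi>) (if j = k then v else 0)" for j k
  proof (cases "j = k")
    case True
    then show ?thesis
      using transfer[OF v_int, of k] by (simp add: U_def v_def power2_eq_square)
  next
    case False
    have ind: "P.indep_vars (\<lambda>_. borel) U {j, k}"
      using indep_U by (rule P.indep_vars_subset) simp
    have U_int: "integrable P (U i)" "integral\<^sup>L P (U i) = 0" for i
      using U1[of i] by (auto simp: has_bochner_integral_iff)
    show ?thesis
      using P.indep_vars_integrable[OF _ ind] P.indep_vars_lebesgue_integral[OF _ ind] False U_int
      by (simp add: has_bochner_integral_iff)
  qed
  have split: "A \<xi> - m = 1 / real N * (\<Sum>k=1..N. U k \<xi>) + (\<mu> - m)" for \<xi>
    using N by (simp add: A_def U_def sum_subtractf field_simps)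
  have expand: "(A \<xi> - m)\<^sup>2 = (1 / (real N)\<^sup>2) * (\<Sum>j=1..N. \<Sum>k=1..N. U j \<xi> * U k \<xi>)
      + (2 * (\<mu> - m) / real N) * (\<Sum>k=1..N. U k \<xi>) + (\<mu> - m)\<^sup>2" for \<xi>
  proof -
    have "(1 / real N * S + d)\<^sup>2 = (1 / (real N)\<^sup>2) * (S * S) + (2 * d / real N) * S + d\<^sup>2" for S d
      by (simp add: power2_eq_square algebra_simps add_divide_distrib)
    then show ?thesis unfolding split sum_product[symmetric] .
  qed
  have hb: "has_bochner_integral P (\<lambda>\<xi>. (A \<xi> - m)\<^sup>2) ((1 / (real N)\<^sup>2) * (\<Sum>j=1..N. \<Sum>k=1..N. if j = k then v else 0)
      + (2 * (\<mu> - m) / real N) * (\<Sum>k=1..N. 0) + (\<mu> - m)\<^sup>2)"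
    unfolding expand
  proof (intro has_bochner_integral_add has_bochner_integral_mult_right has_bochner_integral_sum U1 U2)
    show "has_bochner_integral P (\<lambda>\<xi>. (\<mu> - m)\<^sup>2) ((\<mu> - m)\<^sup>2)"
      by (simp add: has_bochner_integral_iff P.prob_space)
  qed
  have val: "(1 / (real N)\<^sup>2) * (\<Sum>j=1..N. \<Sum>k=1..N. if j = k then v else 0)
      + (2 * (\<mu> - m) / real N) * (\<Sum>k=1..N. 0) + (\<mu> - m)\<^sup>2 = v / real N + (\<mu> - m)\<^sup>2"
    using N by (simp add: power2_eq_square)
  from hb show "integrable P (\<lambda>\<xi>. (A \<xi> - m)\<^sup>2)"
    by (rule integrable.intros)
  have "mean_squared_error P A m = v / real N + (\<mu> - m)\<^sup>2"
    unfolding mean_squared_error_def using hb unfolding val by (rule has_bochner_integral_integral_eq)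
  also have "\<dots> \<le> (\<integral>\<omega>. (Y \<omega>)\<^sup>2 \<partial>M) / real N + (\<mu> - m)\<^sup>2"
    using v_le by (intro add_right_mono divide_right_mono) auto
  finally show "mean_squared_error P A m \<le> (\<integral>\<omega>. (Y \<omega>)\<^sup>2 \<partial>M) / real N + ((\<integral>\<omega>. Y \<omega> \<partial>M) - m)\<^sup>2"
    by (simp add: \<mu>_def)
qed

text \<open>The upper limit is affine in - ln \<epsilon>. For a < 0 the integral stays bounded, for
  a = 0 it is the length of the interval, and for a > 0 the exponential of - a ln \<epsilon> /
  \<alpha> is a power of \<epsilon>.\<close>

lemma exp_integral_log_bound:
  assumes \<alpha>: "\<alpha> > 0" and a0: "a0 \<ge> 0"
  shows "\<exists>C>0. \<forall>\<epsilon>\<in>{0<..<exp (- 1)}. (LBINT l:{0..(a0 - ln \<epsilon>) / \<alpha>}. exp (a * l))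
    \<le> C * (\<epsilon> powr (- (max 0 a / \<alpha>)) * \<bar>ln \<epsilon>\<bar> ^ kronecker_delta a 0)"
proof -
  have ln_less: "ln \<epsilon> < - 1" if "\<epsilon> \<in> {0<..<exp (- 1)}" for \<epsilon> :: real
    using that ln_less_cancel_iff[of \<epsilon> "exp (- 1)"] by simp
  have b: "0 \<le> (a0 - ln \<epsilon>) / \<alpha>" if "\<epsilon> \<in> {0<..<exp (- 1)}" for \<epsilon> :: real
    using ln_less[OF that] \<alpha> a0 by simp
  consider "a < 0" | "a = 0" | "a > 0" by linarith
  then show ?thesis
  proof cases
    case 1
    show ?thesis
    proof (intro exI[of _ "1 / - a"] conjI ballI)
      fix \<epsilon> :: real assume \<epsilon>: "\<epsilon> \<in> {0<..<exp (- 1)}"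
      have "(LBINT l:{0..(a0 - ln \<epsilon>) / \<alpha>}. exp (a * l)) \<le> 1 / - a"
      proof -
        have "(exp (a * ((a0 - ln \<epsilon>) / \<alpha>)) - 1) / a = (1 - exp (a * ((a0 - ln \<epsilon>) / \<alpha>))) / - a"
          by (simp add: minus_divide_left diff_divide_distrib)
        also have "\<dots> \<le> 1 / - a"
          using 1 by (intro divide_right_mono) auto
        finally show ?thesis using 1 b[OF \<epsilon>] by (subst LBINT_exp_Icc) auto
      qed
      then show "(LBINT l:{0..(a0 - ln \<epsilon>) / \<alpha>}. exp (a * l))
          \<le> 1 / - a * (\<epsilon> powr (- (max 0 a / \<alpha>)) * \<bar>ln \<epsilon>\<bar> ^ kronecker_delta a 0)"
        using 1 \<epsilon> by (simp add: kronecker_delta_def max_def)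
    qed (use 1 in simp)
  next
    case 2
    show ?thesis
    proof (intro exI[of _ "(a0 + 1) / \<alpha>"] conjI ballI)
      fix \<epsilon> :: real assume \<epsilon>: "\<epsilon> \<in> {0<..<exp (- 1)}"
      have "(LBINT l:{0..(a0 - ln \<epsilon>) / \<alpha>}. exp (a * l)) = (a0 - ln \<epsilon>) / \<alpha>"
        using 2 b[OF \<epsilon>] by (simp add: set_lebesgue_integral_def)
      also have "\<dots> \<le> (a0 + 1) * \<bar>ln \<epsilon>\<bar> / \<alpha>"
      proof -
        \<comment> \<open>Since \<epsilon> < exp (-1), |ln \<epsilon>| exceeds 1 and absorbs the
          constant a0.\<close>
        have "a0 * 1 \<le> a0 * - ln \<epsilon>"
          using ln_less[OF \<epsilon>] a0 by (intro mult_left_mono) auto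
        then show ?thesis
          using \<alpha> ln_less[OF \<epsilon>] by (intro divide_right_mono) (auto simp: abs_if algebra_simps)
      qed
      finally show "(LBINT l:{0..(a0 - ln \<epsilon>) / \<alpha>}. exp (a * l))
          \<le> (a0 + 1) / \<alpha> * (\<epsilon> powr (- (max 0 a / \<alpha>)) * \<bar>ln \<epsilon>\<bar> ^ kronecker_delta a 0)"
        using 2 \<epsilon> by (simp add: kronecker_delta_def)
    qed (use \<alpha> a0 in simp)
  next
    case 3
    show ?thesis
    proof (intro exI[of _ "exp (a * a0 / \<alpha>) / a"] conjI ballI)
      fix \<epsilon> :: real assume \<epsilon>: "\<epsilon> \<in> {0<..<exp (- 1)}"
      have "exp (a * ((a0 - ln \<epsilon>) / \<alpha>)) = exp (a * a0 / \<alpha>) * exp (- (a / \<alpha>) * ln \<epsilon>)"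
        by (simp add: exp_add[symmetric] diff_divide_distrib right_diff_distrib)
      also have "exp (- (a / \<alpha>) * ln \<epsilon>) = \<epsilon> powr (- (a / \<alpha>))"
        using \<epsilon> by (simp add: powr_def)
      finally have "(LBINT l:{0..(a0 - ln \<epsilon>) / \<alpha>}. exp (a * l)) \<le> exp (a * a0 / \<alpha>) * \<epsilon> powr (- (a / \<alpha>)) / a"
        using 3 b[OF \<epsilon>] by (subst LBINT_exp_Icc) (auto intro!: divide_right_mono)
      then show "(LBINT l:{0..(a0 - ln \<epsilon>) / \<alpha>}. exp (a * l))
          \<le> exp (a * a0 / \<alpha>) / a * (\<epsilon> powr (- (max 0 a / \<alpha>)) * \<bar>ln \<epsilon>\<bar> ^ kronecker_delta a 0)"
        using 3 by (simp add: kronecker_delta_def max_def)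
    qed (use 3 in simp)
  qed
qed

section \<open>Cost and bias of one sample\<close>

context clmc_process
begin

lemma clmc_summand_eq_sample:
  assumes "\<And>l. l > 0 \<Longrightarrow> DQ l \<omega> = D l \<omega>"
  shows "clmc_summand M DQ L b \<omega> = sample b \<omega>"
  unfolding clmc_summand_def sample_def set_lebesgue_integral_def
\<comment> \<open>The integrands can differ only at l = 0, where \<open>DQ\<close> is
  unrestricted.\<close>
proof (rule integral_discrete_difference[where X="{0}"])
  fix l :: real assume "l \<notin> {0}"
  then show "indicat_real {0..b} l *\<^sub>R (1 / prob {\<omega>' \<in> space M. l \<le> L \<omega>'} * DQ l \<omega> * indicat_real {0..L \<omega>} l)
      = indicat_real {0<..b} l *\<^sub>R (exp (r * l) * D l \<omega> * indicat_real {0..L \<omega>} l)"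
    using exponential_distributedD_ge[OF L_exp _ r, of l] assms[of l]
    by (cases "0 < l") (auto simp: exp_minus inverse_eq_divide split: split_indicator)
qed auto

lemma clmc_cost_le:
  assumes cost: "\<And>l. l > 0 \<Longrightarrow> 0 \<le> cost l" "\<And>l. l > 0 \<Longrightarrow> cost l \<le> c * exp (\<gamma> * l)" and c: "0 \<le> c"
  shows "clmc_cost M L cost b N \<le> real N * (c * (LBINT l:{0..b}. exp ((\<gamma> - r) * l)))"
proof -
  let ?h = "\<lambda>l. c * exp (\<gamma> * l)"
  have h: "set_integrable lborel {0..b} ?h"
    by (intro borel_integrable_atLeastAtMost' continuous_intros)
  note trunc = exponential_distributed_truncated_integral[OF L_exp r h]
  have nonneg: "0 \<le> (LBINT l:{0..b}. ?h l * indicator {0..L \<omega>} l)" for \<omega>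
    unfolding set_lebesgue_integral_def using c by (intro Bochner_Integration.integral_nonneg) auto
  have "(LBINT l:{0..min (L \<omega>) b}. cost l) \<le> (LBINT l:{0..b}. ?h l * indicator {0..L \<omega>} l)" for \<omega>
  proof -
    \<comment> \<open>Both bounds on \<open>cost\<close> concern positive levels, so the point 0 is
      dropped before comparing.\<close>
    have "(LBINT l:{0..min (L \<omega>) b}. cost l) = (LBINT l:{0<..min (L \<omega>) b}. cost l)"
      unfolding set_lebesgue_integral_def
      by (rule integral_discrete_difference[where X="{0}"]) (auto split: split_indicator)
    also have "\<dots> \<le> (LBINT l:{0..b}. ?h l * indicator {0..L \<omega>} l)"
      unfolding set_lebesgue_integral_def
    proof (rule integral_mono')
      have "integrable lborel (\<lambda>l. indicator {0..min (L \<omega>) b} l *\<^sub>R ?h l)"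
        unfolding set_integrable_def[symmetric]
        by (intro borel_integrable_atLeastAtMost' continuous_intros)
      also have "(\<lambda>l. indicator {0..min (L \<omega>) b} l *\<^sub>R ?h l) = (\<lambda>l. indicator {0..b} l *\<^sub>R (?h l * indicator {0..L \<omega>} l))"
        by (auto simp: fun_eq_iff split: split_indicator)
      finally show "integrable lborel (\<lambda>l. indicator {0..b} l *\<^sub>R (?h l * indicator {0..L \<omega>} l))" .
    qed (use cost c in \<open>auto split: split_indicator\<close>)
    finally show ?thesis .
  qed
  then have "expectation (\<lambda>\<omega>. LBINT l:{0..min (L \<omega>) b}. cost l)
      \<le> expectation (\<lambda>\<omega>. LBINT l:{0..b}. ?h l * indicator {0..L \<omega>} l)"
    using nonneg by (intro integral_mono'[OF trunc(1)])
  also have "\<dots> = (LBINT l:{0..b}. ?h l * exp (- r * l))"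
    by (rule trunc(2))
  also have "\<dots> = c * (LBINT l:{0..b}. exp ((\<gamma> - r) * l))"
  proof -
    have "exp (\<gamma> * l) * exp (- r * l) = exp ((\<gamma> - r) * l)" for l
      by (simp add: exp_add[symmetric] algebra_simps)
    then show ?thesis by (simp add: mult.assoc set_integral_mult_right)
  qed
  finally show ?thesis
    unfolding clmc_cost_def by (intro mult_left_mono) auto
qed

text \<open>Dominated convergence is applied along each path, in l and with bound |D|; it identifies
  the limiting increment with the full integral of \<open>D\<close>. The exchange with the
  expectation is then Fubini for \<open>D\<close>, so no moment of \<open>Q l\<close>
  enters.\<close>

lemma expectation_limit:
  assumes [measurable]: "QoI \<in> borel_measurable M" "Q 0 \<in> borel_measurable M"
    and lim: "AE \<omega> in M. ((\<lambda>l. Q l \<omega>) \<longlongrightarrow> QoI \<omega>) at_top"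
  shows "integrable lborel (\<lambda>l. expectation (D l))"
    and "expectation (\<lambda>\<omega>. QoI \<omega> - Q 0 \<omega>) = (LBINT l. expectation (D l))"
proof -
  note E = expectation_integral_weighted_D[of "\<lambda>_. 1" 1, simplified]
  show "integrable lborel (\<lambda>l. expectation (D l))" by (rule E(2))
  have "AE \<omega> in M. QoI \<omega> - Q 0 \<omega> = (LBINT l. D l \<omega>)"
    using lim D_FTC AE_integrable_D
  proof eventually_elim
    case (elim \<omega>)
    have "(\<lambda>n. Q (real n) \<omega>) \<longlonglongrightarrow> QoI \<omega>"
      using filterlim_compose[OF elim(1) filterlim_real_sequentially] .
    then have "(\<lambda>n. Q (real n) \<omega> - Q 0 \<omega>) \<longlonglongrightarrow> QoI \<omega> - Q 0 \<omega>"
      by (intro tendsto_intros)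
    moreover have "(\<lambda>n. Q (real n) \<omega> - Q 0 \<omega>) = (\<lambda>n. LBINT l. indicator {0<..real n} l *\<^sub>R D l \<omega>)"
      using elim(2) by (auto simp: set_lebesgue_integral_def)
    moreover have "(\<lambda>n. LBINT l. indicator {0<..real n} l *\<^sub>R D l \<omega>) \<longlonglongrightarrow> (LBINT l. D l \<omega>)"
    proof (rule integral_dominated_convergence[where w="\<lambda>l. \<bar>D l \<omega>\<bar>"])
      show "AE l in lborel. (\<lambda>n. indicator {0<..real n} l *\<^sub>R D l \<omega>) \<longlonglongrightarrow> D l \<omega>"
      proof (intro AE_I2)
        fix l
        obtain n0 where "l \<le> real n0" using real_arch_simple by blast
        then have "eventually (\<lambda>n. D l \<omega> = indicator {0<..real n} l *\<^sub>R D l \<omega>) sequentially"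
          unfolding eventually_sequentially by (intro exI[of _ n0]) (auto split: split_indicator)
        then show "(\<lambda>n. indicator {0<..real n} l *\<^sub>R D l \<omega>) \<longlonglongrightarrow> D l \<omega>"
          by (rule Lim_transform_eventually[OF tendsto_const])
      qed
      show "(\<lambda>l. indicator {0<..real n} l *\<^sub>R D l \<omega>) \<in> borel_measurable lborel" for n
        using elim(3) by measurable
    qed (use elim(3) in \<open>auto split: split_indicator\<close>)
    ultimately show ?case using LIMSEQ_unique by metis
  qed
  then have "expectation (\<lambda>\<omega>. QoI \<omega> - Q 0 \<omega>) = expectation (\<lambda>\<omega>. LBINT l. D l \<omega>)"
    using E(1) by (intro integral_cong_AE) auto
  then show "expectation (\<lambda>\<omega>. QoI \<omega> - Q 0 \<omega>) = (LBINT l. expectation (D l))"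
    using E(3) by simp
qed

text \<open>Both expectations are integrals of the mean derivative, one cut off at b; the bias is
  the tail beyond b.\<close>

lemma sample_bias:
  assumes "QoI \<in> borel_measurable M" "Q 0 \<in> borel_measurable M"
    and "AE \<omega> in M. ((\<lambda>l. Q l \<omega>) \<longlongrightarrow> QoI \<omega>) at_top"
    and mean: "\<And>l. l > 0 \<Longrightarrow> \<bar>expectation (D l)\<bar> \<le> c * exp (- \<alpha> * l)"
    and \<alpha>: "0 < \<alpha>" and c: "0 \<le> c" and b: "0 \<le> b"
  shows "\<bar>expectation (sample b) - expectation (\<lambda>\<omega>. QoI \<omega> - Q 0 \<omega>)\<bar> \<le> c / \<alpha> * exp (- \<alpha> * b)"
proof -
  note lim = expectation_limit[OF assms(1-3)]
  have int: "integrable lborel (\<lambda>l. indicator A l *\<^sub>R expectation (D l))" if "A \<in> sets borel" for A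
    using lim(1) that by (intro integrable_mult_indicator) auto
  have "expectation (\<lambda>\<omega>. QoI \<omega> - Q 0 \<omega>) - expectation (sample b)
      = (LBINT l. expectation (D l) - indicator {0<..b} l *\<^sub>R expectation (D l))"
    unfolding lim(2) expectation_sample(2)[OF b] set_lebesgue_integral_def
    using lim(1) int by (subst Bochner_Integration.integral_diff) auto
  also have "\<dots> = (LBINT l. indicator {b<..} l *\<^sub>R expectation (D l))"
    using b by (intro Bochner_Integration.integral_cong) (auto simp: expectation_D_nonpos split: split_indicator)
  finally have eq: "expectation (\<lambda>\<omega>. QoI \<omega> - Q 0 \<omega>) - expectation (sample b)
      = (LBINT l. indicator {b<..} l *\<^sub>R expectation (D l))" .
  have "ennreal \<bar>LBINT l. indicator {b<..} l *\<^sub>R expectation (D l)\<bar>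
      \<le> (\<integral>\<^sup>+l. ennreal (norm (indicator {b<..} l *\<^sub>R expectation (D l))) \<partial>lborel)"
    using integral_norm_bound_ennreal[OF int[of "{b<..}"]] by simp
  also have "\<dots> \<le> (\<integral>\<^sup>+l. ennreal (c * exp (- \<alpha> * l)) * indicator {b..} l \<partial>lborel)"
    using mean b by (intro nn_integral_mono) (auto intro!: ennreal_leI split: split_indicator)
  also have "\<dots> = 0 - (- (c / \<alpha>) * exp (- \<alpha> * b))"
  proof (rule nn_integral_FTC_atLeast)
    have "((\<lambda>l. - (c / \<alpha>) * exp (- \<alpha> * l)) \<longlongrightarrow> - (c / \<alpha>) * 0) at_top"
      using \<alpha> by (intro tendsto_intros filterlim_compose[OF exp_at_bot] filterlim_tendsto_neg_mult_at_bot[OF tendsto_const] filterlim_ident) auto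
    then show "((\<lambda>l. - (c / \<alpha>) * exp (- \<alpha> * l)) \<longlongrightarrow> 0) at_top" by simp
  qed (use \<alpha> c in \<open>auto intro!: derivative_eq_intros simp: field_simps\<close>)
  finally show ?thesis
    using eq \<alpha> c by (simp add: abs_minus_commute)
qed

end

section \<open>The complexity theorem\<close>

theorem theorem2p3:
  fixes M :: "'a measure" and P :: "'b measure" and X :: "nat \<Rightarrow> 'b \<Rightarrow> 'a"
    and QoI :: "'a \<Rightarrow> real" and Q DQ :: "real \<Rightarrow> 'a \<Rightarrow> real" and L :: "'a \<Rightarrow> real"
    and cost :: "real \<Rightarrow> real" and \<alpha> \<beta> \<gamma> c1 c2 c3 r :: real
  assumes "prob_space M"
    and QoI_rv: "QoI \<in> borel_measurable M"
    and Q_rv: "\<And>l. l \<ge> 0 \<Longrightarrow> Q l \<in> borel_measurable M"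
    and Q_lim: "AE \<omega> in M. ((\<lambda>l. Q l \<omega>) \<longlongrightarrow> QoI \<omega>) at_top"
    and Q_W11: "AE \<omega> in M. (\<lambda>l. Q l \<omega>) \<in> sobolev_W11 {0<..}"
    and Q_cont: "AE \<omega> in M. continuous_on {0..} (\<lambda>l. Q l \<omega>)"
    and DQ_deriv: "AE \<omega> in M. has_weak_derivative {0<..} (\<lambda>l. Q l \<omega>) (\<lambda>l. DQ l \<omega>)"
    and DQ_meas: "(\<lambda>(l, \<omega>). DQ l \<omega>) \<in> borel_measurable (restrict_space borel {0<..} \<Otimes>\<^sub>M M)"
    and DQ_L2: "\<And>l. l > 0 \<Longrightarrow> integrable M (\<lambda>\<omega>. (DQ l \<omega>)\<^sup>2)"
    and cost_meas: "cost \<in> borel_measurable (restrict_space borel {0<..})"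
    and cost_nonneg: "\<And>l. l > 0 \<Longrightarrow> cost l \<ge> 0"
    and samples: "iid_samples M P X"
    and pos: "\<alpha> > 0" "\<beta> > 0" "\<gamma> > 0" "c1 > 0" "c2 > 0" "c3 > 0"
    and "\<beta> \<le> 2 * \<alpha>"
    and i: "\<And>l. l > 0 \<Longrightarrow> \<bar>prob_space.expectation M (DQ l)\<bar> \<le> c1 * exp (- \<alpha> * l)"
    and ii: "\<And>l. l > 0 \<Longrightarrow> prob_space.variance M (DQ l) \<le> c2 * exp (- \<beta> * l)"
    and iii: "\<And>l. l > 0 \<Longrightarrow> cost l \<le> c3 * exp (\<gamma> * l)"
    and L_exp: "distributed M lborel L (exponential_density r)"
    and r: "r \<in> {min \<beta> \<gamma>..max \<beta> \<gamma>}"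
    and L_indep: "indep_rvs M
           (\<Pi>\<^sub>M l\<in>{0..}. borel) (\<lambda>\<omega>. \<lambda>l\<in>{0..}. Q l \<omega>) borel L"
  shows "\<exists>C>0. \<forall>\<epsilon>\<in>{0<..<exp (- 1)}. \<exists>Lmax\<ge>0. \<exists>N::nat. N \<ge> 1 \<and>
           (let Qhat = clmc_estimator M DQ L X Lmax N;
                m = prob_space.expectation M (\<lambda>\<omega>. QoI \<omega> - Q 0 \<omega>)
            in integrable P (\<lambda>\<xi>. (Qhat \<xi> - m)\<^sup>2) \<and> mean_squared_error P Qhat m \<le> \<epsilon>\<^sup>2) \<and>
           clmc_cost M L cost Lmax N
             \<le> C * \<epsilon> powr (- 2 - max 0 ((\<gamma> - \<beta>) / \<alpha>))
                 * \<bar>ln \<epsilon>\<bar> ^ (kronecker_delta r \<beta> + kronecker_delta r \<gamma>)"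
proof -
  interpret prob_space M by fact
  define K where "K = sqrt (c1\<^sup>2 + c2)"
  define D where "D l \<omega> = (if l > 0 then DQ l \<omega> else 0)" for l \<omega>
  have K: "K > 0" "K\<^sup>2 = c1\<^sup>2 + c2"
    using pos by (auto simp: K_def add_nonneg_pos)
  have r0: "r > 0" using r pos by (auto simp: min_def split: if_splits)
  have DQ_eq: "D l = DQ l" if "l > 0" for l
    using that by (auto simp: D_def)
  have DQ_l [measurable]: "DQ l \<in> borel_measurable M" if "l > 0" for l
    using measurable_compose[OF measurable_Pair1'[of l "restrict_space borel {0<..}" M] DQ_meas] that
    by (simp add: space_restrict_space)
  have D_meas: "(\<lambda>(l, \<omega>). D l \<omega>) \<in> borel_measurable (lborel \<Otimes>\<^sub>M M)"
  proof -
    \<comment> \<open>\<open>DQ\<close> is jointly measurable over positive levels only. Sending all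
      other levels to the dummy level 1 gives a measurable map into that domain; the outer case
      distinction discards its values.\<close>
    have "(\<lambda>p. (if fst p > (0::real) then fst p else 1, snd p)) \<in> measurable (lborel \<Otimes>\<^sub>M M) (restrict_space borel {0<..} \<Otimes>\<^sub>M M)"
      by (intro measurable_Pair measurable_restrict_space2) (auto intro!: measurable_If)
    from measurable_compose[OF this DQ_meas]
    have [measurable]: "(\<lambda>p. DQ (if fst p > 0 then fst p else 1) (snd p)) \<in> borel_measurable (lborel \<Otimes>\<^sub>M M)"
      by simp
    have "(\<lambda>p. if fst p > 0 then DQ (if fst p > 0 then fst p else 1) (snd p) else 0) \<in> borel_measurable (lborel \<Otimes>\<^sub>M M)"
      by measurable
    also have "(\<lambda>p. if fst p > 0 then DQ (if fst p > 0 then fst p else 1) (snd p) else 0) = (\<lambda>(l, \<omega>). D l \<omega>)"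
      by (auto simp: D_def)
    finally show ?thesis .
  qed
  have D_L2: "(\<integral>\<^sup>+\<omega>. ennreal ((D l \<omega>)\<^sup>2) \<partial>M) \<le> ennreal (K\<^sup>2 * exp (- \<beta> * l))" if l: "l > 0" for l
  proof -
    have int: "integrable M (DQ l)"
      by (rule square_integrable_imp_integrable[OF DQ_l[OF l] DQ_L2[OF l]])
    have "(\<integral>\<omega>. (DQ l \<omega>)\<^sup>2 \<partial>M) = variance (DQ l) + (expectation (DQ l))\<^sup>2"
      using variance_eq[OF int DQ_L2[OF l]] by simp
    also have "\<dots> \<le> c2 * exp (- \<beta> * l) + (c1 * exp (- \<alpha> * l))\<^sup>2"
      using ii[OF l] power_mono[OF i[OF l] abs_ge_zero, of 2] by simp
    also have "(c1 * exp (- \<alpha> * l))\<^sup>2 = c1\<^sup>2 * exp (- (2 * \<alpha>) * l)"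
      by (simp add: power2_eq_square exp_add[symmetric])
    also have "\<dots> \<le> c1\<^sup>2 * exp (- \<beta> * l)"
      using \<open>\<beta> \<le> 2 * \<alpha>\<close> l by (intro mult_left_mono) auto
    finally have "(\<integral>\<omega>. (DQ l \<omega>)\<^sup>2 \<partial>M) \<le> K\<^sup>2 * exp (- \<beta> * l)"
      by (simp add: K(2) algebra_simps)
    then show ?thesis
      using nn_integral_eq_integral[OF DQ_L2[OF l]] by (simp add: DQ_eq[OF l] ennreal_leI)
  qed
  interpret D: decaying_process M D K \<beta>
    by unfold_locales (use D_meas D_L2 K pos in \<open>auto simp: D_def\<close>)
  have FTC: "AE \<omega> in M. \<forall>a b. 0 \<le> a \<longrightarrow> a \<le> b \<longrightarrow> Q b \<omega> - Q a \<omega> = (LBINT l:{a<..b}. D l \<omega>)"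
    using D.AE_integrable_D Q_cont DQ_deriv
  proof eventually_elim
    case (elim \<omega>)
    have "set_integrable lborel {0<..} (\<lambda>l. DQ l \<omega>)"
    proof -
      have "(\<lambda>l. indicator {0<..} l *\<^sub>R DQ l \<omega>) = (\<lambda>l. D l \<omega>)"
        by (auto simp: D_def split: split_indicator)
      then show ?thesis using elim(1) by (simp add: set_integrable_def)
    qed
    note FTC = weak_derivative_FTC[OF elim(3,2) this]
    have "(LBINT l:{a<..b}. DQ l \<omega>) = (LBINT l:{a<..b}. D l \<omega>)" if "0 \<le> a" for a b
      unfolding set_lebesgue_integral_def using that
      by (intro Bochner_Integration.integral_cong) (auto simp: D_def split: split_indicator)
    then show ?case using FTC by simp
  qed
  interpret C: clmc_process M D K \<beta> Q L r
    by unfold_locales (use r0 L_exp L_indep FTC in auto)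

  \<comment> \<open>The second moment of F t grows like exp (2 s t) for any positive s with 2 s
    \<ge> 2 r - \<beta>. The floor r / 4 keeps s positive when 2 r \<le> \<beta>. The result 2 s - r
    = max (r - \<beta>) (- r / 2) has the same positive part as r - \<beta> and vanishes exactly
    when r = \<beta>.\<close>
  define s where "s = max (r - \<beta> / 2) (r / 4)"
  have s: "0 < s" "2 * r - \<beta> \<le> 2 * s" using r0 by (auto simp: s_def max_def)
  \<comment> \<open>The bias bound c1 / \<alpha> exp (- \<alpha> b) becomes c1 / \<alpha> exp (- a0)
    \<epsilon>, so a0 is chosen to make it at most \<epsilon> / 2; the maximum with 0 keeps the
    level nonnegative.\<close>
  define a0 where "a0 = max 0 (ln (2 * c1 / \<alpha>))"
  define b where "b \<epsilon> = (a0 - ln \<epsilon>) / \<alpha>" for \<epsilon> :: real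
  have a0: "0 \<le> a0" "c1 / \<alpha> * exp (- a0) \<le> 1 / 2"
  proof -
    have "2 * c1 / \<alpha> = exp (ln (2 * c1 / \<alpha>))" using pos by simp
    also have "\<dots> \<le> exp a0" by (simp add: a0_def)
    finally have "2 * c1 / \<alpha> / exp a0 \<le> 1"
      unfolding divide_le_eq_1_pos[OF exp_gt_zero] .
    then have "2 * c1 / \<alpha> / exp a0 / 2 \<le> 1 / 2"
      by (rule divide_right_mono) simp
    moreover have "c1 / \<alpha> * exp (- a0) = 2 * c1 / \<alpha> / exp a0 / 2"
      by (simp add: exp_minus field_simps)
    ultimately show "c1 / \<alpha> * exp (- a0) \<le> 1 / 2" by (simp only:)
  qed (simp add: a0_def)
  define E where "E a \<epsilon> = \<epsilon> powr (- (max 0 a / \<alpha>)) * \<bar>ln \<epsilon>\<bar> ^ kronecker_delta a 0" for a \<epsilon> :: real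
  obtain C1 where C1: "C1 > 0" "\<And>\<epsilon>. \<epsilon> \<in> {0<..<exp (- 1)} \<Longrightarrow> (LBINT l:{0..b \<epsilon>}. exp ((2 * s - r) * l)) \<le> C1 * E (2 * s - r) \<epsilon>"
    using exp_integral_log_bound[OF pos(1) a0(1), of "2 * s - r"] unfolding b_def E_def by blast
  obtain C2 where C2: "C2 > 0" "\<And>\<epsilon>. \<epsilon> \<in> {0<..<exp (- 1)} \<Longrightarrow> (LBINT l:{0..b \<epsilon>}. exp ((\<gamma> - r) * l)) \<le> C2 * E (\<gamma> - r) \<epsilon>"
    using exp_integral_log_bound[OF pos(1) a0(1), of "\<gamma> - r"] unfolding b_def E_def by blast
  \<comment> \<open>Since \<open>E\<close> is at least 1, the summand 1 in the second moment bound
    is absorbed, leaving V times \<open>E\<close>.\<close>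
  define V where "V = (K / s)\<^sup>2 * (1 + 2 * s * C1)"
  have V: "V > 0" using K s C1(1) by (auto simp: V_def intro!: mult_pos_pos add_pos_pos)
  show ?thesis
  \<comment> \<open>\<open>N\<close> is a ceiling, hence at most 2 V E / \<epsilon>^2 + 1, and 1
    \<le> E / \<epsilon>^2: this is the origin of 2 V + 1. The factor c3 C2 comes from the cost per
    sample.\<close>
  proof (rule exI[of _ "(2 * V + 1) * (c3 * C2)"], intro conjI ballI)
    show "0 < (2 * V + 1) * (c3 * C2)" using V C2 pos by simp
    fix \<epsilon> :: real assume \<epsilon>: "\<epsilon> \<in> {0<..<exp (- 1)}"
    then have \<epsilon>_pos: "0 < \<epsilon>" by simp
    have ln_\<epsilon>: "ln \<epsilon> < - 1"
      using \<epsilon> ln_less_cancel_iff[of \<epsilon> "exp (- 1)"] by simp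
    have \<epsilon>_less: "\<epsilon> < 1" using \<epsilon> by (auto intro: order_less_trans[of _ "exp (- 1)"])
    have b0: "0 \<le> b \<epsilon>" using a0 ln_\<epsilon> pos by (simp add: b_def)
    let ?Y = "C.sample (b \<epsilon>)" and ?m = "expectation (\<lambda>\<omega>. QoI \<omega> - Q 0 \<omega>)"
    let ?E1 = "E (2 * s - r) \<epsilon>" and ?E2 = "E (\<gamma> - r) \<epsilon>"
    have E_ge1: "1 \<le> E a \<epsilon>" for a
    proof -
      have "1 \<le> \<epsilon> powr (- (max 0 a / \<alpha>))"
        using powr_mono'[of "- (max 0 a / \<alpha>)" 0 \<epsilon>] \<epsilon>_pos \<epsilon>_less pos by simp
      moreover have "1 \<le> \<bar>ln \<epsilon>\<bar> ^ kronecker_delta a 0"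
        using ln_\<epsilon> by (intro one_le_power) simp
      ultimately have "1 * 1 \<le> E a \<epsilon>"
        unfolding E_def by (intro mult_mono) auto
      then show ?thesis by simp
    qed
    \<comment> \<open>This leaves \<epsilon>^2 / 2 for the averaging error and the other half for
      the squared bias.\<close>
    define N where "N = nat \<lceil>2 * V * ?E1 / \<epsilon>\<^sup>2\<rceil>"
    have quot_pos: "0 < 2 * V * ?E1 / \<epsilon>\<^sup>2" using V E_ge1[of "2 * s - r"] \<epsilon>_pos by simp
    then have N: "1 \<le> N" "2 * V * ?E1 / \<epsilon>\<^sup>2 \<le> real N" "real N \<le> 2 * V * ?E1 / \<epsilon>\<^sup>2 + 1"
      unfolding N_def by linarith+
    have second: "integrable M (\<lambda>\<omega>. (?Y \<omega>)\<^sup>2)" "expectation (\<lambda>\<omega>. (?Y \<omega>)\<^sup>2) \<le> V * ?E1"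
    proof -
      show "integrable M (\<lambda>\<omega>. (?Y \<omega>)\<^sup>2)" by (rule C.sample_second_moment(1)[OF b0 s])
      have "expectation (\<lambda>\<omega>. (?Y \<omega>)\<^sup>2) \<le> (K / s)\<^sup>2 * (1 + 2 * s * (LBINT l:{0..b \<epsilon>}. exp ((2 * s - r) * l)))"
        by (rule C.sample_second_moment(2)[OF b0 s])
      also have "\<dots> \<le> (K / s)\<^sup>2 * (?E1 + 2 * s * (C1 * ?E1))"
        using C1(2)[OF \<epsilon>] E_ge1 s by (intro mult_left_mono add_mono) auto
      finally show "expectation (\<lambda>\<omega>. (?Y \<omega>)\<^sup>2) \<le> V * ?E1" by (simp add: V_def algebra_simps)
    qed
    have bias: "(expectation ?Y - ?m)\<^sup>2 \<le> \<epsilon>\<^sup>2 / 2"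
    proof -
      have "\<bar>expectation ?Y - ?m\<bar> \<le> c1 / \<alpha> * exp (- \<alpha> * b \<epsilon>)"
        using pos i by (intro C.sample_bias QoI_rv Q_rv Q_lim b0) (auto simp: DQ_eq)
      also have "exp (- \<alpha> * b \<epsilon>) = exp (- a0) * \<epsilon>"
      proof -
        have "- \<alpha> * b \<epsilon> = - a0 + ln \<epsilon>" using pos by (simp add: b_def)
        then show ?thesis using \<epsilon>_pos by (simp only: exp_add exp_ln)
      qed
      also have "c1 / \<alpha> * (exp (- a0) * \<epsilon>) \<le> 1 / 2 * \<epsilon>"
        using mult_right_mono[OF a0(2), of \<epsilon>] \<epsilon>_pos by (simp add: mult.assoc)
      finally have "\<bar>expectation ?Y - ?m\<bar>\<^sup>2 \<le> (1 / 2 * \<epsilon>)\<^sup>2"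
        by (intro power_mono) auto
      also have "(1 / 2 * \<epsilon>)\<^sup>2 \<le> \<epsilon>\<^sup>2 / 2"
        by (simp add: power2_eq_square)
      finally show ?thesis by simp
    qed
    have estimator: "clmc_estimator M DQ L X (b \<epsilon>) N = (\<lambda>\<xi>. 1 / real N * (\<Sum>k=1..N. ?Y (X k \<xi>)))"
    proof -
      have "clmc_summand M DQ L (b \<epsilon>) \<omega> = ?Y \<omega>" for \<omega>
        by (rule C.clmc_summand_eq_sample) (simp add: DQ_eq)
      then show ?thesis by (simp add: clmc_estimator_def[abs_def])
    qed
    note mc = monte_carlo_mse[OF \<open>prob_space M\<close> samples C.sample_meas second(1) N(1), of ?m]
    have "expectation (\<lambda>\<omega>. (?Y \<omega>)\<^sup>2) / real N \<le> \<epsilon>\<^sup>2 / 2"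
    proof -
      have "2 * (V * ?E1) \<le> real N * \<epsilon>\<^sup>2"
        using N(2) \<epsilon>_pos by (simp add: pos_divide_le_eq)
      then show ?thesis using second(2) N(1) by (simp add: pos_divide_le_eq mult.commute)
    qed
    from order_trans[OF mc(2) add_mono[OF this bias]]
    have mse: "integrable P (\<lambda>\<xi>. (clmc_estimator M DQ L X (b \<epsilon>) N \<xi> - ?m)\<^sup>2)"
      "mean_squared_error P (clmc_estimator M DQ L X (b \<epsilon>) N) ?m \<le> \<epsilon>\<^sup>2"
      using mc(1) unfolding estimator by auto
    have "clmc_cost M L cost (b \<epsilon>) N \<le> real N * (c3 * (LBINT l:{0..b \<epsilon>}. exp ((\<gamma> - r) * l)))"
      using pos by (intro C.clmc_cost_le cost_nonneg iii) auto
    also have "\<dots> \<le> ((2 * V + 1) * ?E1 * \<epsilon> powr (- 2)) * (c3 * (C2 * ?E2))"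
    proof (rule mult_mono)
      have "1 \<le> ?E1 / \<epsilon>\<^sup>2"
        using E_ge1[of "2 * s - r"] \<epsilon>_pos \<epsilon>_less power_le_one[of \<epsilon> 2] by (simp add: le_divide_eq)
      then have "real N \<le> (2 * V + 1) * (?E1 / \<epsilon>\<^sup>2)"
        using N(3) by (simp add: distrib_right add_divide_distrib)
      moreover have "\<epsilon> powr (- 2) = 1 / \<epsilon>\<^sup>2"
        using \<epsilon>_pos by (simp add: powr_minus divide_inverse powr_numeral)
      ultimately show "real N \<le> (2 * V + 1) * ?E1 * \<epsilon> powr (- 2)" by simp
      show "0 \<le> c3 * (LBINT l:{0..b \<epsilon>}. exp ((\<gamma> - r) * l))"
        using pos unfolding set_lebesgue_integral_def
        by (intro mult_nonneg_nonneg Bochner_Integration.integral_nonneg) auto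
      show "c3 * (LBINT l:{0..b \<epsilon>}. exp ((\<gamma> - r) * l)) \<le> c3 * (C2 * ?E2)"
        using C2(2)[OF \<epsilon>] pos by (intro mult_left_mono) auto
    qed (use pos V E_ge1[of "2 * s - r"] in auto)
    also have "\<dots> = (2 * V + 1) * (c3 * C2) * (\<epsilon> powr (- 2) * (?E1 * ?E2))"
      by (simp add: mult_ac)
    also have "\<epsilon> powr (- 2) * (?E1 * ?E2) = \<epsilon> powr (- 2 - max 0 ((\<gamma> - \<beta>) / \<alpha>))
        * \<bar>ln \<epsilon>\<bar> ^ (kronecker_delta r \<beta> + kronecker_delta r \<gamma>)"
    proof -
      have "kronecker_delta (2 * s - r) 0 = kronecker_delta r \<beta>" "kronecker_delta (\<gamma> - r) 0 = kronecker_delta r \<gamma>"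
        using r0 by (auto simp: kronecker_delta_def s_def max_def)
      \<comment> \<open>Here the range of r is decisive: for \<beta> \<le> r \<le> \<gamma> the
        parts r - \<beta> and \<gamma> - r add up to \<gamma> - \<beta>, and for \<gamma> \<le> r
        \<le> \<beta> all three positive parts vanish.\<close>
      moreover have "max 0 (2 * s - r) + max 0 (\<gamma> - r) = max 0 (\<gamma> - \<beta>)"
        using r r0 by (auto simp: s_def max_def min_def split: if_splits)
      then have "max 0 (2 * s - r) / \<alpha> + max 0 (\<gamma> - r) / \<alpha> = max 0 ((\<gamma> - \<beta>) / \<alpha>)"
        using pos by (simp only: add_divide_distrib[symmetric]) (auto simp: max_def zero_le_divide_iff)
      then have "- 2 - max 0 ((\<gamma> - \<beta>) / \<alpha>) = - 2 + (- (max 0 (2 * s - r) / \<alpha>) + - (max 0 (\<gamma> - r) / \<alpha>))"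
        by simp
      ultimately show ?thesis
        unfolding E_def by (simp only: powr_add power_add mult_ac)
    qed
    finally have cost_le: "clmc_cost M L cost (b \<epsilon>) N \<le> (2 * V + 1) * (c3 * C2) * \<epsilon> powr (- 2 - max 0 ((\<gamma> - \<beta>) / \<alpha>))
        * \<bar>ln \<epsilon>\<bar> ^ (kronecker_delta r \<beta> + kronecker_delta r \<gamma>)"
      by (simp only: mult.assoc)
    show "\<exists>Lmax\<ge>0. \<exists>N::nat. N \<ge> 1 \<and>
           (let Qhat = clmc_estimator M DQ L X Lmax N;
                m = prob_space.expectation M (\<lambda>\<omega>. QoI \<omega> - Q 0 \<omega>)
            in integrable P (\<lambda>\<xi>. (Qhat \<xi> - m)\<^sup>2) \<and> mean_squared_error P Qhat m \<le> \<epsilon>\<^sup>2) \<and>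
           clmc_cost M L cost Lmax N
             \<le> (2 * V + 1) * (c3 * C2) * \<epsilon> powr (- 2 - max 0 ((\<gamma> - \<beta>) / \<alpha>))
                 * \<bar>ln \<epsilon>\<bar> ^ (kronecker_delta r \<beta> + kronecker_delta r \<gamma>)"
      using b0 N(1) mse cost_le unfolding Let_def by blast
  qed
qed

end
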